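(* Let $G=(V,E)$ be a locally finite, connected graph that has a closed, transitive and nonunimodular subgroup of automorphisms. Let $u_n$ and $f_n$ be the $n$-step return probability and the first return probability at time $n$ of simple random walk on $G$. Then there are constants $c>0$ and $c'>0$ such that $f_n\ge c'\,\dfrac{u_n}{n^{c}}$ for all $n\ge1$.
   Context: $\mathrm{Aut}(G)$ is the group of automorphisms of $G$, with the topology generated by its action on $G$ (pointwise convergence); it is a locally compact group, and "closed" refers to this topology. A subgroup $\Gamma\subset\mathrm{Aut}(G)$ is transitive if for all $x,y\in V$ there is $\gamma\in\Gamma$ with $\gamma(x)=y$. $\Gamma$ is unimodular if its left Haar measure is also a right Haar measure, and nonunimodular otherwise. For simple random walk $(X_n)_{n\ge0}$ on $G$, $u_n=\mathbb P_x[X_n=x]$ and $f_n=\mathbb P_x[X_n=x,\ X_i\ne x\text{ for }1\le i\le n-1]$ for $n\ge1$; these do not depend on $x\in V$ when $G$ is transitive. *)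

theory Defs
  imports "HOL-Probability.Probability" "HOL-Algebra.Bij" "HOL-Algebra.Coset"
begin

section \<open>Graphs\<close>

definition simple_graph :: "'a set \<Rightarrow> 'a set set \<Rightarrow> bool" where
  "simple_graph V E \<longleftrightarrow> E \<subseteq> {{x, y} | x y. x \<in> V \<and> y \<in> V \<and> x \<noteq> y}"

definition neighbours :: "'a set set \<Rightarrow> 'a \<Rightarrow> 'a set" where
  "neighbours E x = {y. {x, y} \<in> E}"

definition locally_finite_graph :: "'a set \<Rightarrow> 'a set set \<Rightarrow> bool" where
  "locally_finite_graph V E \<longleftrightarrow> (\<forall>x\<in>V. finite (neighbours E x))"

definition connected_graph :: "'a set \<Rightarrow> 'a set set \<Rightarrow> bool" where
  "connected_graph V E \<longleftrightarrow>
     V \<noteq> {} \<and> (\<forall>x\<in>V. \<forall>y\<in>V. (x, y) \<in> {(a, b). {a, b} \<in> E}\<^sup>*)"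


section \<open>The automorphism group and its topology\<close>

text \<open>As in \<^const>\<open>BijGroup\<close>, an automorphism is represented by the bijection of \<open>V\<close> which is
  \<^const>\<open>undefined\<close> outside \<open>V\<close>, so that distinct functions are distinct automorphisms.\<close>

definition graph_auts :: "'a set \<Rightarrow> 'a set set \<Rightarrow> ('a \<Rightarrow> 'a) set" where
  "graph_auts V E = {f \<in> Bij V. \<forall>x\<in>V. \<forall>y\<in>V. {f x, f y} \<in> E \<longleftrightarrow> {x, y} \<in> E}"

definition aut_group :: "'a set \<Rightarrow> 'a set set \<Rightarrow> ('a \<Rightarrow> 'a) monoid" where
  "aut_group V E = BijGroup V \<lparr>carrier := graph_auts V E\<rparr>"

lemma group_aut_group: "group (aut_group V E)"
proof -
  have "subgroup (graph_auts V E) (BijGroup V)"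
  proof (rule group.subgroupI[OF group_BijGroup])
    show "graph_auts V E \<subseteq> carrier (BijGroup V)"
      by (auto simp: graph_auts_def BijGroup_def)
    show "graph_auts V E \<noteq> {}"
      using id_Bij[of V] by (auto simp: graph_auts_def intro!: exI[of _ "\<lambda>x\<in>V. x"])
  next
    fix f assume f: "f \<in> graph_auts V E"
    hence bij: "bij_betw f V V" by (auto simp: graph_auts_def Bij_def)
    have "{inv_into V f x, inv_into V f y} \<in> E \<longleftrightarrow> {x, y} \<in> E" if "x \<in> V" "y \<in> V" for x y
    proof -
      have "inv_into V f x \<in> V" "inv_into V f y \<in> V"
        using that bij_betwE[OF bij_betw_inv_into[OF bij]] by auto
      hence "{f (inv_into V f x), f (inv_into V f y)} \<in> E \<longleftrightarrow>
          {inv_into V f x, inv_into V f y} \<in> E"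
        using f by (simp add: graph_auts_def)
      thus ?thesis
        using that by (simp add: bij_betw_inv_into_right[OF bij])
    qed
    thus "inv\<^bsub>BijGroup V\<^esub> f \<in> graph_auts V E"
      using f restrict_inv_into_Bij[of f V] by (auto simp: graph_auts_def inv_BijGroup)
  next
    fix f g assume "f \<in> graph_auts V E" "g \<in> graph_auts V E"
    thus "f \<otimes>\<^bsub>BijGroup V\<^esub> g \<in> graph_auts V E"
      using compose_Bij[of f V g] Bij_imp_funcset[of g V]
      by (auto simp: graph_auts_def BijGroup_def compose_def Pi_iff)
  qed
  thus ?thesis
    unfolding aut_group_def by (rule subgroup.subgroup_is_group) (rule group_BijGroup)
qed

text \<open>Pointwise convergence, \<open>V\<close> being discrete.\<close>

definition aut_topology :: "'a set \<Rightarrow> 'a set set \<Rightarrow> ('a \<Rightarrow> 'a) topology" where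
  "aut_topology V E =
     subtopology (product_topology (\<lambda>_. discrete_topology V) V) (graph_auts V E)"

definition transitive_on :: "('a \<Rightarrow> 'a) set \<Rightarrow> 'a set \<Rightarrow> bool" where
  "transitive_on \<Gamma> V \<longleftrightarrow> (\<forall>x\<in>V. \<forall>y\<in>V. \<exists>\<gamma>\<in>\<Gamma>. \<gamma> x = y)"


section \<open>Haar measure and unimodularity\<close>

definition radon_measure :: "'g topology \<Rightarrow> 'g measure \<Rightarrow> bool" where
  "radon_measure T M \<longleftrightarrow>
     space M = topspace T \<and>
     sets M = sigma_sets (topspace T) {U. openin T U} \<and>
     (\<forall>K. compactin T K \<longrightarrow> emeasure M K < \<infinity>) \<and>
     (\<forall>A\<in>sets M. emeasure M A = (INF U\<in>{U. openin T U \<and> A \<subseteq> U}. emeasure M U)) \<and>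
     (\<forall>U. openin T U \<longrightarrow> emeasure M U = (SUP K\<in>{K. compactin T K \<and> K \<subseteq> U}. emeasure M K))"

definition left_haar_measure :: "('g, 'b) monoid_scheme \<Rightarrow> 'g topology \<Rightarrow> 'g measure \<Rightarrow> bool" where
  "left_haar_measure G T M \<longleftrightarrow>
     radon_measure T M \<and> emeasure M (space M) \<noteq> 0 \<and>
     (\<forall>g\<in>carrier G. \<forall>A\<in>sets M. emeasure M (g <#\<^bsub>G\<^esub> A) = emeasure M A)"

definition right_haar_measure :: "('g, 'b) monoid_scheme \<Rightarrow> 'g topology \<Rightarrow> 'g measure \<Rightarrow> bool" where
  "right_haar_measure G T M \<longleftrightarrow>
     radon_measure T M \<and> emeasure M (space M) \<noteq> 0 \<and>
     (\<forall>g\<in>carrier G. \<forall>A\<in>sets M. emeasure M (A #>\<^bsub>G\<^esub> g) = emeasure M A)"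

text \<open>For a locally compact Hausdorff group a left Haar measure exists and is unique up to a
  positive factor, so the quantifier ranges over the multiples of one measure.\<close>

definition unimodular :: "('g, 'b) monoid_scheme \<Rightarrow> 'g topology \<Rightarrow> bool" where
  "unimodular G T \<longleftrightarrow> (\<forall>M. left_haar_measure G T M \<longrightarrow> right_haar_measure G T M)"


section \<open>Simple random walk\<close>

text \<open>The law of \<open>(X\<^sub>0, \<dots>, X\<^sub>n)\<close>, as a list of length \<open>n + 1\<close>, for simple random walk
  started at \<open>x\<close>. The step distribution is only meaningful at vertices whose set of neighbours
  is finite and nonempty.\<close>

primrec srw :: "'a set set \<Rightarrow> 'a \<Rightarrow> nat \<Rightarrow> 'a list pmf" where
  "srw E x 0 = return_pmf [x]"
| "srw E x (Suc n) =
     bind_pmf (srw E x n) (\<lambda>xs. map_pmf (\<lambda>y. xs @ [y]) (pmf_of_set (neighbours E (last xs))))"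

definition return_prob :: "'a set set \<Rightarrow> 'a \<Rightarrow> nat \<Rightarrow> real" where
  "return_prob E x n = measure_pmf.prob (srw E x n) {xs. xs ! n = x}"

definition first_return_prob :: "'a set set \<Rightarrow> 'a \<Rightarrow> nat \<Rightarrow> real" where
  "first_return_prob E x n =
     measure_pmf.prob (srw E x n) {xs. xs ! n = x \<and> (\<forall>i\<in>{1..<n}. xs ! i \<noteq> x)}"

end

theory Submission
  imports Defs
begin

text \<open>
  The exponent \<open>c = 1\<close> works, and the idea is to turn a closed walk of length \<open>n\<close> into a first return
  of length \<open>n + 2\<close> by a detour to a vertex that the walk never visits.

  Let \<open>m(x)\<close> be the Haar measure of the stabiliser of \<open>x\<close>. Invariance of Haar measure gives the mass
  transport principle (\<open>mass_transport\<close>): if \<open>f(x, y)\<close> is invariant under the diagonal action, then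
  \<open>m(o) \<Sum>\<^sub>y f(o, y) = \<Sum>\<^sub>y f(y, o) m(y)\<close>. The order of \<open>m(x)\<close> and \<open>m(y)\<close> is invariant too, because
  \<open>m(x) / m(y)\<close> is a ratio of orbit sizes. If \<open>m\<close> were constant, every left Haar measure would be a
  right Haar measure (\<open>right_haar_if_weight_constant\<close>). So \<open>m\<close> is not constant, some edge has ends of
  different weight, and by transitivity every vertex has a strictly heavier neighbour.

  In a closed walk of length \<open>n\<close> at \<open>o\<close> pick a heaviest vertex \<open>z\<close> and insert a step to a heavier
  neighbour \<open>y\<close> of \<open>z\<close> and back. The new walk has length \<open>n + 2\<close>, visits \<open>y\<close> exactly once, and
  \<open>m(o) < m(y)\<close>. Started at \<open>y\<close> instead, it is a first return to \<open>y\<close>. Moving the starting point from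
  \<open>o\<close> to \<open>y\<close> is a mass transport: it turns walks from \<open>o\<close> with marked vertex \<open>y\<close> into walks from \<open>y\<close>
  with marked vertex \<open>o\<close>, counted with the factor \<open>m(y) / m(o)\<close>. Now \<open>o\<close> is the heavier of the two,
  the factor is at most \<open>1\<close>, and for each of the \<open>n + 1\<close> possible positions of the detour these walks
  are at most as many as the first returns at \<open>o\<close>. With \<open>d\<close> the degree this reads
  \<open>u\<^sub>n \<le> (n + 1) d\<^sup>2 f\<^bsub>n+2\<^esub>\<close> (\<open>return_prob_le_first_return_prob\<close>).

  It remains to compare \<open>u\<^sub>n\<close> with \<open>u\<^bsub>n-2\<^esub>\<close>. Since the transition matrix is symmetric,
  \<open>u\<^bsub>2m+k\<^esub> \<le> u\<^bsub>2m\<^esub>\<close> for all \<open>k\<close> (\<open>return_prob_even\<close>), which settles even \<open>n\<close>. For odd \<open>n\<close> let \<open>s\<close> be the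
  smallest odd number with \<open>u\<^sub>s > 0\<close>. Then
  \<open>u\<^bsub>n-2\<^esub> \<ge> u\<^sub>s u\<^bsub>n-2-s\<^esub> \<ge> u\<^sub>s u\<^sub>n\<close> for \<open>n \<ge> s + 2\<close>, while \<open>f\<^sub>s = u\<^sub>s\<close> because a closed walk of
  length \<open>s\<close> that returned earlier would contain a shorter odd closed walk.
\<close>

section \<open>Counting walks\<close>

definition walks_from :: "'a set set \<Rightarrow> 'a \<Rightarrow> nat \<Rightarrow> 'a list set" where
  "walks_from E x n = {xs. length xs = Suc n \<and> hd xs = x \<and> successively (\<lambda>a b. {a, b} \<in> E) xs}"

definition walks_between :: "'a set set \<Rightarrow> 'a \<Rightarrow> 'a \<Rightarrow> nat \<Rightarrow> 'a list set" where
  "walks_between E x y n = {xs \<in> walks_from E x n. last xs = y}"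

definition first_return_walks :: "'a set set \<Rightarrow> 'a \<Rightarrow> nat \<Rightarrow> 'a list set" where
  "first_return_walks E x n = {xs \<in> walks_between E x x n. \<forall>i\<in>{1..<n}. xs ! i \<noteq> x}"

lemma walks_between_nth:
  "xs \<in> walks_between E x y n \<longleftrightarrow>
     length xs = Suc n \<and> xs ! 0 = x \<and> xs ! n = y \<and> (\<forall>i<n. {xs ! i, xs ! Suc i} \<in> E)"
  by (cases "xs = []")
    (auto simp: walks_between_def walks_from_def hd_conv_nth last_conv_nth successively_conv_nth)

lemma walks_from_0: "walks_from E x 0 = {[x]}"
  by (auto simp: walks_from_def length_Suc_conv)

lemma walks_from_snoc:
  "xs @ [y] \<in> walks_from E x (Suc n) \<longleftrightarrow> xs \<in> walks_from E x n \<and> y \<in> neighbours E (last xs)"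
  by (cases "xs = []") (auto simp: walks_from_def neighbours_def successively_append_iff)

lemma walks_from_Suc:
  "walks_from E x (Suc n) = (\<lambda>(xs, y). xs @ [y]) ` (SIGMA xs:walks_from E x n. neighbours E (last xs))"
proof (intro equalityI subsetI)
  fix zs assume zs: "zs \<in> walks_from E x (Suc n)"
  hence "zs \<noteq> []" by (auto simp: walks_from_def)
  then obtain xs y where "zs = xs @ [y]" by (metis append_butlast_last_id)
  thus "zs \<in> (\<lambda>(xs, y). xs @ [y]) ` (SIGMA xs:walks_from E x n. neighbours E (last xs))"
    using zs by (auto simp: walks_from_snoc intro!: image_eqI[of _ _ "(xs, y)"])
qed (auto simp: walks_from_snoc)

lemma walks_between_rev:
  assumes "xs \<in> walks_between E x y n" shows "rev xs \<in> walks_between E y x n"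
proof -
  have "successively (\<lambda>a b. {b, a} \<in> E) xs" if "successively (\<lambda>a b. {a, b} \<in> E) xs"
    by (rule successively_mono[OF that]) (simp add: insert_commute)
  thus ?thesis using assms
    by (simp add: walks_between_def walks_from_def hd_rev last_rev)
qed

lemma card_walks_between_sym: "card (walks_between E x y n) = card (walks_between E y x n)"
  by (rule bij_betw_same_card[of rev])
    (auto intro!: bij_betwI[where g = rev] walks_between_rev)

lemma walks_between_join:
  assumes p: "p \<in> walks_between E x y m" and q: "q \<in> walks_between E y z n"
  shows "p @ tl q \<in> walks_between E x z (m + n)"
proof -
  obtain q' where [simp]: "q = y # q'"
    using q by (cases q) (auto simp: walks_between_def walks_from_def)
  show ?thesis using p q
    by (cases p)
      (auto simp: walks_between_def walks_from_def successively_append_iff successively_Cons split: if_splits)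
qed

lemma walks_between_split:
  assumes "xs \<in> walks_between E x z (m + n)"
  shows "take (Suc m) xs \<in> walks_between E x (xs ! m) m" "drop m xs \<in> walks_between E (xs ! m) z n"
  using assms by (auto simp: walks_between_nth)

text \<open>The Chapman--Kolmogorov equation for numbers of walks. The set \<open>B\<close> of midpoints is arbitrary as
  long as it is finite and large enough, so that one set can serve in several such sums.\<close>

lemma card_walks_between_add:
  assumes B: "finite B" "\<And>y. walks_between E x y m \<noteq> {} \<Longrightarrow> walks_between E y z n \<noteq> {} \<Longrightarrow> y \<in> B"
    and fin: "\<And>y. finite (walks_between E x y m)" "\<And>y. y \<in> B \<Longrightarrow> finite (walks_between E y z n)"
  shows "card (walks_between E x z (m + n)) =
    (\<Sum>y\<in>B. card (walks_between E x y m) * card (walks_between E y z n))"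
proof -
  define J :: "'a list \<times> 'a list \<Rightarrow> 'a list" where "J = (\<lambda>(p, q). p @ tl q)"
  define W where "W y = walks_between E x y m \<times> walks_between E y z n" for y
  have J: "take (Suc m) (J (p, q)) = p \<and> drop (Suc m) (J (p, q)) = tl q" if "(p, q) \<in> W y" for p q y
    using that by (auto simp: J_def W_def walks_between_nth)
  have inj: "inj_on J (W y)" for y
  proof (rule inj_onI)
    fix a b assume ab: "a \<in> W y" "b \<in> W y" "J a = J b"
    obtain p q p' q' where [simp]: "a = (p, q)" "b = (p', q')" by (cases a, cases b)
    have "p = p'" "tl q = tl q'" using J[of p q y] J[of p' q' y] ab by auto
    moreover have "hd q = y" "hd q' = y" "q \<noteq> []" "q' \<noteq> []"
      using ab by (auto simp: W_def walks_between_def walks_from_def)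
    ultimately show "a = b" by (metis \<open>a = (p, q)\<close> \<open>b = (p', q')\<close> list.expand)
  qed
  have eq: "walks_between E x z (m + n) = (\<Union>y\<in>B. J ` W y)"
  proof (intro equalityI subsetI)
    fix xs assume xs: "xs \<in> walks_between E x z (m + n)"
    note s = walks_between_split[OF xs]
    have "tl (drop m xs) = drop (Suc m) xs" by (simp add: drop_Suc drop_tl)
    hence "xs = J (take (Suc m) xs, drop m xs)" by (simp add: J_def)
    moreover have "xs ! m \<in> B" using s B(2) by blast
    ultimately show "xs \<in> (\<Union>y\<in>B. J ` W y)" using s by (auto simp: W_def)
  qed (auto simp: W_def J_def intro: walks_between_join)
  have "card (\<Union>y\<in>B. J ` W y) = (\<Sum>y\<in>B. card (J ` W y))"
  proof (rule card_UN_disjoint)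
    show "\<forall>y\<in>B. \<forall>y'\<in>B. y \<noteq> y' \<longrightarrow> J ` W y \<inter> J ` W y' = {}"
    proof (intro ballI impI)
      fix y y' :: 'a assume "y \<noteq> y'"
      have "J (p, q) ! m = y" if "(p, q) \<in> W y" for p q y
        using that by (auto simp: J_def W_def walks_between_nth nth_append)
      hence "a ! m = y" if "a \<in> J ` W y" for a y using that by auto
      thus "J ` W y \<inter> J ` W y' = {}" using \<open>y \<noteq> y'\<close> by blast
    qed
  qed (use B fin in \<open>auto simp: W_def\<close>)
  also have "\<dots> = (\<Sum>y\<in>B. card (W y))" by (simp add: card_image inj)
  finally show ?thesis by (simp add: eq W_def card_cartesian_product)
qed

text \<open>A return strictly before time \<open>n\<close> splits a closed walk into two shorter ones, and one of them has
  odd length when \<open>n\<close> is odd.\<close>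

lemma first_return_walks_eq_walks_between:
  assumes "odd n" and "\<And>k. odd k \<Longrightarrow> k < n \<Longrightarrow> walks_between E x x k = {}"
  shows "first_return_walks E x n = walks_between E x x n"
proof -
  have "xs ! i \<noteq> x" if xs: "xs \<in> walks_between E x x n" and i: "1 \<le> i" "i < n" for xs i
  proof
    assume [simp]: "xs ! i = x"
    have "xs \<in> walks_between E x x (i + (n - i))" using xs i by simp
    from walks_between_split[OF this]
    have "walks_between E x x i \<noteq> {}" "walks_between E x x (n - i) \<noteq> {}" by auto
    moreover have "odd i \<or> odd (n - i)" using \<open>odd n\<close> i by auto
    ultimately show False using assms(2)[of i] assms(2)[of "n - i"] i by auto
  qed
  thus ?thesis by (force simp: first_return_walks_def)
qed

section \<open>Walks in regular graphs\<close>

locale regular_graph =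
  fixes V :: "'a set" and E :: "'a set set" and d :: nat
  assumes neighbours_subset: "x \<in> V \<Longrightarrow> neighbours E x \<subseteq> V"
    and finite_neighbours: "x \<in> V \<Longrightarrow> finite (neighbours E x)"
    and card_neighbours: "x \<in> V \<Longrightarrow> card (neighbours E x) = d"
    and degree_pos: "d > 0"
begin

lemma walks_from_subset:
  assumes "x \<in> V" "xs \<in> walks_from E x n" shows "set xs \<subseteq> V"
  using assms(2)
proof (induction n arbitrary: xs)
  case 0 thus ?case using assms(1) by (simp add: walks_from_0)
next
  case (Suc n)
  obtain ys y where ys: "xs = ys @ [y]" "ys \<in> walks_from E x n" "y \<in> neighbours E (last ys)"
    using Suc.prems by (auto simp: walks_from_Suc)
  have "ys \<noteq> []" using ys(2) by (auto simp: walks_from_def)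
  hence "last ys \<in> V" using Suc.IH[OF ys(2)] last_in_set by blast
  hence "y \<in> V" using ys(3) neighbours_subset by blast
  thus ?case using ys(1) Suc.IH[OF ys(2)] by simp
qed

lemma last_walk_in:
  assumes "x \<in> V" "xs \<in> walks_from E x n" shows "last xs \<in> V"
proof -
  have "xs \<noteq> []" using assms by (auto simp: walks_from_def)
  thus ?thesis using walks_from_subset[OF assms] last_in_set by blast
qed

lemma finite_card_walks_from:
  assumes "x \<in> V" shows "finite (walks_from E x n) \<and> card (walks_from E x n) = d ^ n"
proof (induction n)
  case (Suc n)
  have inj: "inj_on (\<lambda>(xs, y). xs @ [y]) A" for A :: "('a list \<times> 'a) set"
    by (auto simp: inj_on_def)
  have fin: "\<forall>xs\<in>walks_from E x n. finite (neighbours E (last xs))"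
    using last_walk_in[OF assms] finite_neighbours by blast
  have "card (walks_from E x (Suc n)) = (\<Sum>xs\<in>walks_from E x n. card (neighbours E (last xs)))"
    using Suc fin by (simp add: walks_from_Suc card_image inj)
  also have "\<dots> = d ^ n * d" using Suc last_walk_in[OF assms] by (simp add: card_neighbours)
  finally show ?case using Suc fin by (auto simp: walks_from_Suc mult.commute)
qed (simp add: walks_from_0)

lemmas finite_walks_from = conjunct1[OF finite_card_walks_from]
  and card_walks_from = conjunct2[OF finite_card_walks_from]

lemma finite_walks_between: "x \<in> V \<Longrightarrow> finite (walks_between E x y n)"
  using finite_walks_from by (simp add: walks_between_def)

lemma walks_from_nonempty: "x \<in> V \<Longrightarrow> walks_from E x n \<noteq> {}"
  using card_walks_from[of x n] degree_pos by force

text \<open>By regularity all walks of length \<open>n\<close> are equally likely, so probabilities are normalised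
  numbers of walks.\<close>

lemma srw_eq_uniform:
  assumes "x \<in> V" shows "srw E x n = pmf_of_set (walks_from E x n)"
proof (induction n)
  case 0 show ?case by (simp add: walks_from_0 pmf_of_set_singleton)
next
  case (Suc n)
  note fin = finite_walks_from[OF assms] and ne = walks_from_nonempty[OF assms]
  show ?case
  proof (rule pmf_eqI)
    fix zs
    let ?N = "\<lambda>xs. neighbours E (last xs)"
    have N: "finite (?N xs)" "card (?N xs) = d" "?N xs \<noteq> {}" if "xs \<in> walks_from E x n" for xs
      using last_walk_in[OF assms that] finite_neighbours[of "last xs"] card_neighbours[of "last xs"] degree_pos
      by auto
    have step: "pmf (map_pmf (\<lambda>y. xs @ [y]) (pmf_of_set (?N xs))) zs =
        (if zs \<noteq> [] \<and> xs = butlast zs \<and> zs \<in> walks_from E x (Suc n) then 1 / d else 0)"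
      if xs: "xs \<in> walks_from E x n" for xs
    proof (cases "zs \<noteq> [] \<and> xs = butlast zs")
      case True
      define y where "y = last zs"
      have zs: "zs = xs @ [y]" using True by (auto simp: y_def)
      have "pmf (map_pmf (\<lambda>y. xs @ [y]) (pmf_of_set (?N xs))) zs = pmf (pmf_of_set (?N xs)) y"
        unfolding zs by (rule pmf_map_inj') (auto simp: inj_def)
      moreover have "zs \<in> walks_from E x (Suc n) \<longleftrightarrow> y \<in> ?N xs"
        using xs by (auto simp: zs walks_from_Suc)
      ultimately show ?thesis using True N[OF xs] by (simp add: indicator_def)
    next
      case False
      hence "zs \<notin> range (\<lambda>y. xs @ [y])" by auto
      hence "pmf (map_pmf (\<lambda>y. xs @ [y]) (pmf_of_set (?N xs))) zs = 0"
        by (intro pmf_map_outside) auto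
      thus ?thesis using False by auto
    qed
    have mem: "butlast zs \<in> walks_from E x n" "zs \<noteq> []" if "zs \<in> walks_from E x (Suc n)"
      using that by (auto simp: walks_from_Suc)
    have "pmf (srw E x (Suc n)) zs =
        (\<Sum>xs\<in>walks_from E x n. if zs \<noteq> [] \<and> xs = butlast zs \<and> zs \<in> walks_from E x (Suc n) then 1 / d else 0) / d ^ n"
      by (simp add: Suc pmf_bind_pmf_of_set[OF ne fin] card_walks_from[OF assms] step)
    also have "\<dots> = (if zs \<in> walks_from E x (Suc n) then 1 / d ^ Suc n else 0)"
      using mem fin[of n] by (cases "zs \<in> walks_from E x (Suc n)") (simp_all add: mult.commute)
    also have "\<dots> = pmf (pmf_of_set (walks_from E x (Suc n))) zs"
      using ne fin by (simp add: card_walks_from[OF assms] indicator_def)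
    finally show "pmf (srw E x (Suc n)) zs = pmf (pmf_of_set (walks_from E x (Suc n))) zs" .
  qed
qed

lemma return_prob_eq:
  assumes "x \<in> V" shows "return_prob E x n = card (walks_between E x x n) / d ^ n"
proof -
  have "walks_from E x n \<inter> {xs. xs ! n = x} = walks_between E x x n"
    by (auto simp: walks_between_def walks_from_def) (metis diff_Suc_1 last_conv_nth length_0_conv nat.distinct(1))+
  thus ?thesis
    using finite_walks_from[OF assms] walks_from_nonempty[OF assms]
    by (simp add: return_prob_def srw_eq_uniform[OF assms] measure_pmf_of_set card_walks_from[OF assms])
qed

lemma first_return_prob_eq:
  assumes "x \<in> V" shows "first_return_prob E x n = card (first_return_walks E x n) / d ^ n"
proof -
  have "walks_from E x n \<inter> {xs. xs ! n = x \<and> (\<forall>i\<in>{1..<n}. xs ! i \<noteq> x)} = first_return_walks E x n"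
    by (auto simp: first_return_walks_def walks_between_def walks_from_def) (metis diff_Suc_1 last_conv_nth length_0_conv nat.distinct(1))+
  thus ?thesis
    using finite_walks_from[OF assms] walks_from_nonempty[OF assms]
    by (simp add: first_return_prob_def srw_eq_uniform[OF assms] measure_pmf_of_set card_walks_from[OF assms])
qed

text \<open>Write \<open>a(y)\<close> for the number of walks of length \<open>m\<close> from \<open>x\<close> to \<open>y\<close> and \<open>N\<close> for the symmetric matrix of
  numbers of walks of length \<open>k\<close>, whose row sums are at most \<open>d\<^sup>k\<close>. The left side is the quadratic form
  \<open>\<langle>a, N a\<rangle>\<close>, which is at most \<open>d\<^sup>k \<parallel>a\<parallel>\<^sup>2\<close>, and \<open>\<parallel>a\<parallel>\<^sup>2\<close> counts closed walks of length \<open>2 m\<close>. This is an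
  elementary substitute for the bound on the spectrum of the transition operator.\<close>

lemma card_closed_walks_le:
  assumes x: "x \<in> V"
  shows "card (walks_between E x x (2 * m + k)) \<le> d ^ k * card (walks_between E x x (2 * m))"
proof -
  define B where "B = last ` walks_from E x m"
  have B: "finite B" "B \<subseteq> V"
    using finite_walks_from[OF x] last_walk_in[OF x] by (auto simp: B_def)
  have inB: "y \<in> B" if "walks_between E x y m \<noteq> {}" for y
    using that by (auto simp: B_def walks_between_def)
  have inB': "y \<in> B" if "walks_between E y x m \<noteq> {}" for y
    using that walks_between_rev[of _ E y x m] inB by blast
  have fin: "finite (walks_between E y z n)" if "y \<in> B" for y z n
    using that B finite_walks_between by blast
  define a where "a y = real (card (walks_between E x y m))" for y
  define N where "N y z = real (card (walks_between E y z k))" for y z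
  have sq: "real (card (walks_between E x x (2 * m))) = (\<Sum>y\<in>B. (a y)\<^sup>2)"
  proof -
    have "card (walks_between E x x (m + m)) =
        (\<Sum>y\<in>B. card (walks_between E x y m) * card (walks_between E y x m))"
      using B inB finite_walks_between[OF x] fin by (intro card_walks_between_add) auto
    thus ?thesis
      by (simp add: a_def power2_eq_square card_walks_between_sym[of E _ x m] mult_2)
  qed
  have N_sum: "(\<Sum>z\<in>B. N y z) \<le> d ^ k" if "y \<in> B" for y
  proof -
    have "(\<Sum>z\<in>B. card (walks_between E y z k)) = card (\<Union>z\<in>B. walks_between E y z k)"
      using B fin that by (intro card_UN_disjoint[symmetric]) (auto simp: walks_between_def)
    also have "\<dots> \<le> card (walks_from E y k)"
      using that B by (intro card_mono finite_walks_from) (auto simp: walks_between_def)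
    also have "\<dots> = d ^ k" using that B by (auto simp: card_walks_from)
    finally have "real (\<Sum>z\<in>B. card (walks_between E y z k)) \<le> real (d ^ k)" by (rule of_nat_mono)
    thus ?thesis by (simp add: N_def)
  qed
  have N_sym: "N y z = N z y" for y z by (simp add: N_def card_walks_between_sym)
  have "card (walks_between E x x (m + (k + m))) =
      (\<Sum>y\<in>B. card (walks_between E x y m) * card (walks_between E y x (k + m)))"
    using B inB finite_walks_between[OF x] fin by (intro card_walks_between_add) auto
  also have "\<dots> = (\<Sum>y\<in>B. card (walks_between E x y m) *
      (\<Sum>z\<in>B. card (walks_between E y z k) * card (walks_between E z x m)))"
    using B inB' fin by (intro sum.cong refl arg_cong2[where f = "(*)"] card_walks_between_add) auto
  finally have "real (card (walks_between E x x (2 * m + k))) = (\<Sum>y\<in>B. a y * (\<Sum>z\<in>B. N y z * a z))"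
    by (simp add: a_def N_def card_walks_between_sym[of E _ x m] mult_2 add_ac)
  also have "\<dots> = (\<Sum>y\<in>B. \<Sum>z\<in>B. N y z * (a y * a z))"
    by (simp add: sum_distrib_left mult_ac)
  also have "\<dots> \<le> (\<Sum>y\<in>B. \<Sum>z\<in>B. N y z * (((a y)\<^sup>2 + (a z)\<^sup>2) / 2))"
    by (intro sum_mono mult_left_mono) (use sum_squares_bound in \<open>auto simp: N_def field_simps\<close>)
  also have "\<dots> = (\<Sum>y\<in>B. \<Sum>z\<in>B. N y z * (a y)\<^sup>2 / 2) + (\<Sum>y\<in>B. \<Sum>z\<in>B. N z y * (a z)\<^sup>2 / 2)"
    by (simp add: sum.distrib[symmetric] field_simps N_sym)
  also have "(\<Sum>y\<in>B. \<Sum>z\<in>B. N z y * (a z)\<^sup>2 / 2) = (\<Sum>y\<in>B. \<Sum>z\<in>B. N y z * (a y)\<^sup>2 / 2)"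
    by (rule sum.swap)
  also have "(\<Sum>y\<in>B. \<Sum>z\<in>B. N y z * (a y)\<^sup>2 / 2) + (\<Sum>y\<in>B. \<Sum>z\<in>B. N y z * (a y)\<^sup>2 / 2) =
      (\<Sum>y\<in>B. (\<Sum>z\<in>B. N y z) * (a y)\<^sup>2)"
    by (simp add: sum.distrib[symmetric] sum_distrib_right)
  also have "\<dots> \<le> (\<Sum>y\<in>B. d ^ k * (a y)\<^sup>2)"
    by (intro sum_mono mult_right_mono N_sum) auto
  also have "\<dots> = real (d ^ k * card (walks_between E x x (2 * m)))"
    by (simp add: sq sum_distrib_left)
  finally show ?thesis by linarith
qed

text \<open>Closed walks at the same vertex can be concatenated.\<close>

lemma card_closed_walks_supermultiplicative:
  assumes "x \<in> V"
  shows "card (walks_between E x x m) * card (walks_between E x x n) \<le> card (walks_between E x x (m + n))"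
proof -
  have "card ((\<lambda>(p, q). p @ tl q) ` (walks_between E x x m \<times> walks_between E x x n))
      \<le> card (walks_between E x x (m + n))"
    using assms by (intro card_mono finite_walks_between) (auto intro: walks_between_join)
  moreover have "inj_on (\<lambda>(p, q). p @ tl q) (walks_between E x x m \<times> walks_between E x x n)"
  proof (rule inj_onI, clarify)
    fix p q p' q' assume a: "p \<in> walks_between E x x m" "p' \<in> walks_between E x x m"
      "q \<in> walks_between E x x n" "q' \<in> walks_between E x x n" "p @ tl q = p' @ tl q'"
    hence "p = p'" "tl q = tl q'" by (auto simp: walks_between_nth)
    moreover have "hd q = x" "hd q' = x" "q \<noteq> []" "q' \<noteq> []"
      using a by (auto simp: walks_between_def walks_from_def)
    ultimately show "p = p' \<and> q = q'" by (metis list.expand)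
  qed
  ultimately show ?thesis by (simp add: card_image card_cartesian_product)
qed

end

section \<open>The acting group\<close>

locale transitive_action =
  fixes V :: "'a set" and E :: "'a set set" and \<Gamma> :: "('a \<Rightarrow> 'a) set"
  assumes simple: "simple_graph V E" and locally_finite: "locally_finite_graph V E"
    and connected: "connected_graph V E"
    and subgroup: "subgroup \<Gamma> (aut_group V E)" and transitive: "transitive_on \<Gamma> V"
begin

lemma edge_in_V: "{x, y} \<in> E \<Longrightarrow> x \<in> V \<and> y \<in> V \<and> x \<noteq> y"
  using simple by (auto simp: simple_graph_def doubleton_eq_iff dest!: subsetD)

lemma graph_aut: "\<gamma> \<in> \<Gamma> \<Longrightarrow> \<gamma> \<in> graph_auts V E"
  using subgroup.subset[OF subgroup] by (auto simp: aut_group_def)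

lemma act_bij: "\<gamma> \<in> \<Gamma> \<Longrightarrow> bij_betw \<gamma> V V"
  using graph_aut by (auto simp: graph_auts_def Bij_def)

lemma act_in: "\<gamma> \<in> \<Gamma> \<Longrightarrow> x \<in> V \<Longrightarrow> \<gamma> x \<in> V"
  using act_bij bij_betwE by blast

lemma act_inj: "\<gamma> \<in> \<Gamma> \<Longrightarrow> x \<in> V \<Longrightarrow> y \<in> V \<Longrightarrow> \<gamma> x = \<gamma> y \<longleftrightarrow> x = y"
  using act_bij by (meson bij_betw_def inj_on_eq_iff)

lemma act_ext: "\<gamma> \<in> \<Gamma> \<Longrightarrow> \<gamma> \<in> extensional V"
  using graph_aut by (auto simp: graph_auts_def Bij_def)

lemma act_edge: "\<gamma> \<in> \<Gamma> \<Longrightarrow> x \<in> V \<Longrightarrow> y \<in> V \<Longrightarrow> {\<gamma> x, \<gamma> y} \<in> E \<longleftrightarrow> {x, y} \<in> E"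
  using graph_aut by (auto simp: graph_auts_def)

abbreviation G :: "('a \<Rightarrow> 'a) monoid" where "G \<equiv> (aut_group V E)\<lparr>carrier := \<Gamma>\<rparr>"

lemma mult_eq: "\<gamma> \<in> \<Gamma> \<Longrightarrow> \<delta> \<in> \<Gamma> \<Longrightarrow> \<gamma> \<otimes>\<^bsub>aut_group V E\<^esub> \<delta> = compose V \<gamma> \<delta>"
  using graph_aut by (auto simp: aut_group_def BijGroup_def graph_auts_def)

lemma compose_closed: "\<gamma> \<in> \<Gamma> \<Longrightarrow> \<delta> \<in> \<Gamma> \<Longrightarrow> compose V \<gamma> \<delta> \<in> \<Gamma>"
  using subgroup.m_closed[OF subgroup] mult_eq by metis

definition inverse_act :: "('a \<Rightarrow> 'a) \<Rightarrow> 'a \<Rightarrow> 'a" where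
  "inverse_act \<gamma> = inv\<^bsub>aut_group V E\<^esub> \<gamma>"

lemma inverse_act:
  assumes \<gamma>: "\<gamma> \<in> \<Gamma>"
  shows "inverse_act \<gamma> \<in> \<Gamma>" "x \<in> V \<Longrightarrow> inverse_act \<gamma> (\<gamma> x) = x" "x \<in> V \<Longrightarrow> \<gamma> (inverse_act \<gamma> x) = x"
proof -
  interpret A: group "aut_group V E" by (rule group_aut_group)
  show inv: "inverse_act \<gamma> \<in> \<Gamma>"
    unfolding inverse_act_def by (rule subgroup.m_inv_closed[OF subgroup \<gamma>])
  have "\<gamma> \<in> carrier (aut_group V E)" using graph_aut[OF \<gamma>] by (simp add: aut_group_def)
  hence "compose V (inverse_act \<gamma>) \<gamma> = \<one>\<^bsub>aut_group V E\<^esub>" "compose V \<gamma> (inverse_act \<gamma>) = \<one>\<^bsub>aut_group V E\<^esub>"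
    using \<gamma> inv by (simp_all add: mult_eq[symmetric] inverse_act_def)
  hence "compose V (inverse_act \<gamma>) \<gamma> = (\<lambda>x\<in>V. x)" "compose V \<gamma> (inverse_act \<gamma>) = (\<lambda>x\<in>V. x)"
    by (simp_all add: aut_group_def BijGroup_def)
  thus "x \<in> V \<Longrightarrow> inverse_act \<gamma> (\<gamma> x) = x" "x \<in> V \<Longrightarrow> \<gamma> (inverse_act \<gamma> x) = x"
    by (metis compose_eq restrict_apply')+
qed

lemma act_ext_eq: "\<gamma> \<in> \<Gamma> \<Longrightarrow> \<delta> \<in> \<Gamma> \<Longrightarrow> (\<And>x. x \<in> V \<Longrightarrow> \<gamma> x = \<delta> x) \<Longrightarrow> \<gamma> = \<delta>"
  using act_ext by (metis extensionalityI)

lemma l_coset_eq: "\<gamma> \<in> \<Gamma> \<Longrightarrow> A \<subseteq> \<Gamma> \<Longrightarrow> \<gamma> <#\<^bsub>G\<^esub> A = compose V \<gamma> ` A"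
  by (auto simp: l_coset_def mult_eq subset_iff)

lemma r_coset_eq: "\<gamma> \<in> \<Gamma> \<Longrightarrow> A \<subseteq> \<Gamma> \<Longrightarrow> A #>\<^bsub>G\<^esub> \<gamma> = (\<lambda>\<delta>. compose V \<delta> \<gamma>) ` A"
  by (auto simp: r_coset_def mult_eq subset_iff)

lemma transE:
  assumes "x \<in> V" "y \<in> V" obtains \<gamma> where "\<gamma> \<in> \<Gamma>" "\<gamma> x = y"
  using assms transitive unfolding transitive_on_def by blast

text \<open>The end points of walks of length exactly \<open>n\<close>. These finite sets exhaust the graph, and, like the
  balls, each of them is mapped into itself by any edge-preserving map that fixes the centre.\<close>

definition sphere :: "'a \<Rightarrow> nat \<Rightarrow> 'a set" where
  "sphere x n = ({(a, b). {a, b} \<in> E} ^^ n) `` {x}"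

lemma sphere_0: "sphere x 0 = {x}" and sphere_Suc: "sphere x (Suc n) = (\<Union>y\<in>sphere x n. neighbours E y)"
  by (auto simp: sphere_def neighbours_def)

lemma finite_sphere: "x \<in> V \<Longrightarrow> finite (sphere x n) \<and> sphere x n \<subseteq> V"
proof (induction n)
  case (Suc n)
  thus ?case using locally_finite edge_in_V
    unfolding sphere_Suc locally_finite_graph_def neighbours_def by blast
qed (simp add: sphere_0)

lemma sphere_invariant:
  assumes "f x = x" "\<And>y z. {y, z} \<in> E \<Longrightarrow> {f y, f z} \<in> E"
  shows "f ` sphere x n \<subseteq> sphere x n"
proof (induction n)
  case (Suc n)
  show ?case
  proof
    fix w assume "w \<in> f ` sphere x (Suc n)"
    then obtain y z where yz: "w = f z" "y \<in> sphere x n" "{y, z} \<in> E"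
      by (auto simp: sphere_Suc neighbours_def)
    thus "w \<in> sphere x (Suc n)" using Suc assms(2)[of y z] by (auto simp: sphere_Suc neighbours_def)
  qed
qed (simp add: sphere_0 assms)

lemma in_some_sphere: "x \<in> V \<Longrightarrow> y \<in> V \<Longrightarrow> \<exists>n. y \<in> sphere x n"
  using connected by (auto simp: connected_graph_def sphere_def rtrancl_power)

lemma countable_V: "countable V"
proof -
  obtain x where x: "x \<in> V" using connected by (auto simp: connected_graph_def)
  have "V \<subseteq> (\<Union>n. sphere x n)" using in_some_sphere[OF x] by auto
  moreover have "countable (\<Union>n. sphere x n)"
    using finite_sphere[OF x] by (auto intro: countable_finite)
  ultimately show ?thesis by (rule countable_subset)
qed

text \<open>The prescription of finitely many values. These sets are the basic open sets of the topology of
  pointwise convergence, and \<open>cyl xs xs\<close> is the pointwise stabiliser of \<open>xs\<close>. Lists, rather than finite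
  partial maps, make translation by a group element a plain \<^const>\<open>map\<close>.\<close>

definition cyl :: "'a list \<Rightarrow> 'a list \<Rightarrow> ('a \<Rightarrow> 'a) set" where
  "cyl xs ys = {\<gamma> \<in> \<Gamma>. map \<gamma> xs = ys}"

lemma map_compose: "set xs \<subseteq> V \<Longrightarrow> map (compose V \<delta> \<gamma>) xs = map \<delta> (map \<gamma> xs)"
  by (induction xs) (auto simp: compose_eq)

lemma cyl_left:
  assumes "\<gamma> \<in> \<Gamma>" "set xs \<subseteq> V" "set ys \<subseteq> V"
  shows "\<gamma> <#\<^bsub>G\<^esub> cyl xs ys = cyl xs (map \<gamma> ys)"
proof -
  define \<gamma>' where "\<gamma>' = inverse_act \<gamma>"
  note \<gamma>' = inverse_act[OF assms(1), folded \<gamma>'_def]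
  have sub: "cyl xs ys \<subseteq> \<Gamma>" by (auto simp: cyl_def)
  show ?thesis unfolding l_coset_eq[OF assms(1) sub]
  proof (intro equalityI subsetI)
    fix \<delta> assume d: "\<delta> \<in> cyl xs (map \<gamma> ys)"
    define \<epsilon> where "\<epsilon> = compose V \<gamma>' \<delta>"
    have dG: "\<delta> \<in> \<Gamma>" using d by (simp add: cyl_def)
    have eG: "\<epsilon> \<in> \<Gamma>" unfolding \<epsilon>_def by (intro compose_closed \<gamma>' dG)
    have "compose V \<gamma> \<epsilon> = \<delta>"
      by (rule act_ext_eq) (auto simp: compose_closed assms eG dG compose_eq \<epsilon>_def \<gamma>' act_in)
    moreover have "map \<epsilon> xs = ys"
    proof -
      have "map \<epsilon> xs = map \<gamma>' (map \<delta> xs)"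
        using assms by (simp add: \<epsilon>_def map_compose)
      also have "\<dots> = map \<gamma>' (map \<gamma> ys)" using d by (simp add: cyl_def)
      also have "\<dots> = ys" unfolding map_map
        using assms \<gamma>' by (intro map_idI) auto
      finally show ?thesis .
    qed
    ultimately show "\<delta> \<in> compose V \<gamma> ` cyl xs ys" using eG by (auto simp: cyl_def)
  qed (use assms in \<open>auto simp: cyl_def compose_closed map_compose\<close>)
qed

lemma cyl_right:
  assumes "\<gamma> \<in> \<Gamma>" "set xs \<subseteq> V"
  shows "{\<delta> \<in> \<Gamma>. compose V \<delta> \<gamma> \<in> cyl xs ys} = cyl (map \<gamma> xs) ys"
  using assms compose_closed by (auto simp: cyl_def map_compose)

lemma cyl_append: "length xs = length ys \<Longrightarrow> cyl (xs @ xs') (ys @ ys') = cyl xs ys \<inter> cyl xs' ys'"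
  by (auto simp: cyl_def)

lemma cyl_stabiliser_swap: "cyl (xs @ ys) (xs @ ys) = cyl (ys @ xs) (ys @ xs)"
  by (auto simp: cyl_def)

section \<open>The topology of the acting group\<close>

definition T :: "('a \<Rightarrow> 'a) topology" where
  "T = subtopology (aut_topology V E) \<Gamma>"

lemma T_eq: "T = subtopology (product_topology (\<lambda>_. discrete_topology V) V) \<Gamma>"
proof -
  have "graph_auts V E \<inter> \<Gamma> = \<Gamma>" using graph_aut by auto
  thus ?thesis by (simp add: T_def aut_topology_def subtopology_subtopology)
qed

lemma Gamma_PiE: "\<Gamma> \<subseteq> PiE V (\<lambda>_. V)"
  using act_in act_ext unfolding PiE_def Pi_def by blast

lemma topspace_T: "topspace T = \<Gamma>"
  using Gamma_PiE by (auto simp: T_eq)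

lemma openin_cyl: "set xs \<subseteq> V \<Longrightarrow> openin T (cyl xs ys)"
proof (induction xs arbitrary: ys)
  case Nil
  have "cyl [] ys = (if ys = [] then topspace T else {})" by (auto simp: cyl_def topspace_T)
  thus ?case by simp
next
  case (Cons x xs)
  show ?case
  proof (cases ys)
    case (Cons y ys')
    have "continuous_map T (discrete_topology V) (\<lambda>\<gamma>. \<gamma> x)"
      unfolding T_eq using Cons.prems
      by (intro continuous_map_from_subtopology continuous_map_product_projection) auto
    from openin_continuous_map_preimage[OF this, of "{y} \<inter> V"]
    have "openin T {\<gamma> \<in> \<Gamma>. \<gamma> x \<in> {y} \<inter> V}" by (simp add: topspace_T)
    also have "{\<gamma> \<in> \<Gamma>. \<gamma> x \<in> {y} \<inter> V} = {\<gamma> \<in> \<Gamma>. \<gamma> x = y}" using Cons.prems act_in by auto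
    finally have "openin T ({\<gamma> \<in> \<Gamma>. \<gamma> x = y} \<inter> cyl xs ys')"
      using Cons.IH Cons.prems by (intro openin_Int) auto
    also have "{\<gamma> \<in> \<Gamma>. \<gamma> x = y} \<inter> cyl xs ys' = cyl (x # xs) ys" by (auto simp: cyl_def Cons)
    finally show ?thesis .
  qed (simp add: cyl_def)
qed

lemma cyl_nbhd:
  assumes U: "openin T U" and \<gamma>: "\<gamma> \<in> U"
  obtains xs where "set xs \<subseteq> V" "cyl xs (map \<gamma> xs) \<subseteq> U"
proof -
  obtain W where W: "openin (product_topology (\<lambda>_. discrete_topology V) V) W" "U = W \<inter> \<Gamma>"
    using U by (auto simp: T_eq openin_subtopology)
  have "\<gamma> \<in> W" using W \<gamma> by auto
  then obtain S where S: "finite {i \<in> V. S i \<noteq> V}" "\<gamma> \<in> PiE V S" "PiE V S \<subseteq> W"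
    using W(1) by (auto simp: openin_product_topology_alt)
  obtain xs where xs: "set xs = {i \<in> V. S i \<noteq> V}" using finite_list[OF S(1)] by blast
  have "\<delta> \<in> U" if d: "\<delta> \<in> cyl xs (map \<gamma> xs)" for \<delta>
  proof -
    have dG: "\<delta> \<in> \<Gamma>" and eq: "\<And>x. x \<in> set xs \<Longrightarrow> \<delta> x = \<gamma> x" using d by (auto simp: cyl_def)
    have "\<delta> i \<in> S i" if "i \<in> V" for i
      using that xs eq[of i] S(2) act_in[OF dG, of i] by (cases "S i = V") (auto simp: PiE_iff)
    hence "\<delta> \<in> PiE V S" using act_ext[OF dG] by (simp add: PiE_iff)
    thus ?thesis using S(3) W(2) dG by auto
  qed
  thus ?thesis using that[of xs] xs by auto
qed

definition cylinders :: "('a \<Rightarrow> 'a) set set" where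
  "cylinders = {cyl xs ys | xs ys. set xs \<subseteq> V \<and> set ys \<subseteq> V \<and> length xs = length ys}"

lemma countable_cylinders: "countable cylinders"
proof -
  have "cylinders \<subseteq> (\<lambda>(xs, ys). cyl xs ys) ` (lists V \<times> lists V)"
    by (auto simp: cylinders_def lists_eq_set)
  thus ?thesis using countable_V by (auto intro: countable_subset)
qed

lemma Int_stable_cylinders: "Int_stable cylinders"
proof (rule Int_stableI)
  fix A B assume "A \<in> cylinders" "B \<in> cylinders"
  then obtain xs ys xs' ys' where "A = cyl xs ys" "B = cyl xs' ys'" "set xs \<subseteq> V" "set ys \<subseteq> V"
    "set xs' \<subseteq> V" "set ys' \<subseteq> V" "length xs = length ys" "length xs' = length ys'"
    by (auto simp: cylinders_def)
  thus "A \<inter> B \<in> cylinders" unfolding cylinders_def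
    by (intro CollectI exI[of _ "xs @ xs'"] exI[of _ "ys @ ys'"]) (auto simp: cyl_append)
qed

text \<open>The vertex set is countable, hence so is the basis of cylinders, and every open set is a countable
  union of them.\<close>

lemma sigma_sets_cylinders: "sigma_sets \<Gamma> {U. openin T U} = sigma_sets \<Gamma> cylinders"
proof (rule sigma_sets_eqI)
  fix U assume "U \<in> {U. openin T U}"
  hence U: "openin T U" by simp
  define C where "C = {A \<in> cylinders. A \<subseteq> U}"
  have "U \<subseteq> \<Union>C"
  proof
    fix \<gamma> assume \<gamma>: "\<gamma> \<in> U"
    hence G: "\<gamma> \<in> \<Gamma>" using openin_subset[OF U] by (auto simp: topspace_T)
    obtain xs where xs: "set xs \<subseteq> V" "cyl xs (map \<gamma> xs) \<subseteq> U" using cyl_nbhd[OF U \<gamma>] .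
    have "\<gamma> \<in> cyl xs (map \<gamma> xs)" using G by (simp add: cyl_def)
    moreover have "cyl xs (map \<gamma> xs) \<in> C"
      using xs act_in[OF G] unfolding C_def cylinders_def by fastforce
    ultimately show "\<gamma> \<in> \<Union>C" by blast
  qed
  hence U_eq: "U = \<Union>C" by (auto simp: C_def)
  have "countable C" using countable_cylinders by (auto simp: C_def intro: countable_subset)
  thus "U \<in> sigma_sets \<Gamma> cylinders"
    unfolding U_eq by (rule sigma_sets_UNION) (auto simp: C_def)
next
  fix A assume "A \<in> cylinders"
  thus "A \<in> sigma_sets \<Gamma> {U. openin T U}" by (auto simp: cylinders_def openin_cyl)
qed

text \<open>Automorphisms that fix \<open>x\<close> move every vertex within a finite sphere around \<open>x\<close>, so they lie in a
  product of finite sets. Being an injective, edge-preserving map is a closed condition there. A limit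
  of automorphisms could fail to be surjective in general, but an injective map of a finite
  sphere into itself is onto, so for maps fixing \<open>x\<close> surjectivity survives the limit.\<close>

lemma compactin_vertex_stabiliser:
  assumes closed: "closedin (aut_topology V E) \<Gamma>" and x: "x \<in> V"
  shows "compactin T (cyl [x] [x])"
proof -
  let ?P = "product_topology (\<lambda>_. discrete_topology V) V"
  have "\<forall>y\<in>V. \<exists>n. y \<in> sphere x n" using in_some_sphere[OF x] by blast
  then obtain r where r: "\<And>y. y \<in> V \<Longrightarrow> y \<in> sphere x (r y)" by metis
  define K where "K = PiE V (\<lambda>y. sphere x (r y))"
  have K: "compactin ?P K"
    unfolding K_def using finite_sphere[OF x] by (auto simp: compactin_PiE finite_imp_compactin_eq)
  define C where "C y z = {f \<in> topspace ?P. (f y = f z \<longrightarrow> y = z) \<and> ({f y, f z} \<in> E \<longleftrightarrow> {y, z} \<in> E) \<and> f x = x}" for y z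
  \<comment> \<open>Each condition concerns two coordinates only; a case distinction on the value \<open>a\<close> of the first reduces it to one.\<close>
  have closedC: "closedin ?P (C y z)" if yz: "y \<in> V" "z \<in> V" for y z
  proof -
    have *: "closedin ?P {f \<in> topspace ?P. f i \<in> S}" if "i \<in> V" "S \<subseteq> V" for i S
      using that
      by (intro closedin_continuous_map_preimage[where Y = "discrete_topology V"]
          continuous_map_product_projection) auto
    have imp: "closedin ?P {f \<in> topspace ?P. f y \<in> {a} \<longrightarrow> f z \<in> S}" if "S \<subseteq> V" for a S
    proof -
      have "{f \<in> topspace ?P. f y \<in> {a} \<longrightarrow> f z \<in> S} =
          {f \<in> topspace ?P. f y \<in> V - {a}} \<union> {f \<in> topspace ?P. f z \<in> S}"
        using yz by (auto simp: PiE_iff)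
      thus ?thesis using *[OF yz(1), of "V - {a}"] *[OF yz(2) that] by (auto intro: closedin_Un)
    qed
    have "closedin ?P (\<Inter>a\<in>V. {f \<in> topspace ?P. f y \<in> {a} \<longrightarrow>
        f z \<in> {b \<in> V. (a = b \<longrightarrow> y = z) \<and> ({a, b} \<in> E \<longleftrightarrow> {y, z} \<in> E)}})"
      using x by (intro closedin_INT imp) auto
    moreover have "closedin ?P {f \<in> topspace ?P. f x \<in> {x}}" using x by (intro *) auto
    ultimately have "closedin ?P ((\<Inter>a\<in>V. {f \<in> topspace ?P. f y \<in> {a} \<longrightarrow>
        f z \<in> {b \<in> V. (a = b \<longrightarrow> y = z) \<and> ({a, b} \<in> E \<longleftrightarrow> {y, z} \<in> E)}}) \<inter> {f \<in> topspace ?P. f x \<in> {x}})"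
      by (rule closedin_Int)
    also have "\<dots> = C y z" using x yz by (auto simp: C_def PiE_iff)
    finally show ?thesis .
  qed
  define L where "L = K \<inter> (\<Inter>y\<in>V. \<Inter>z\<in>V. C y z)"
  have "closedin ?P (\<Inter>y\<in>V. \<Inter>z\<in>V. C y z)"
    using x closedC by (intro closedin_INT) auto
  hence L: "compactin ?P L"
    unfolding L_def using compact_Int_closedin[OF K] by blast
  have L_auts: "L \<subseteq> graph_auts V E"
  proof
    fix f assume f: "f \<in> L"
    have edge: "{f y, f z} \<in> E \<longleftrightarrow> {y, z} \<in> E" and inj: "f y = f z \<Longrightarrow> y = z"
      if "y \<in> V" "z \<in> V" for y z
      using f that by (auto simp: L_def C_def)
    have fV: "f \<in> PiE V (\<lambda>_. V)" and fx: "f x = x" using f x by (auto simp: L_def C_def)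
    have sph: "f ` sphere x n \<subseteq> sphere x n" for n
      using edge edge_in_V by (intro sphere_invariant fx) blast
    have inj_on: "inj_on f V" using inj by (auto simp: inj_on_def)
    have "y \<in> f ` V" if y: "y \<in> V" for y
    proof -
      note fs = finite_sphere[OF x, of "r y"]
      \<comment> \<open>Finiteness turns injectivity into surjectivity.\<close>
      have "f ` sphere x (r y) = sphere x (r y)"
        using fs inj_on sph by (intro endo_inj_surj) (auto intro: inj_on_subset)
      thus ?thesis using r[OF y] fs by blast
    qed
    hence "bij_betw f V V" using inj_on fV by (auto simp: bij_betw_def)
    thus "f \<in> graph_auts V E" using fV edge by (auto simp: graph_auts_def Bij_def PiE_iff)
  qed
  have "compactin (aut_topology V E) L"
    using L L_auts by (simp add: aut_topology_def compactin_subtopology)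
  hence "compactin (aut_topology V E) (\<Gamma> \<inter> L)"
    using closed by (rule closed_Int_compactin[rotated])
  hence "compactin T (\<Gamma> \<inter> L)" by (simp add: T_def compactin_subtopology)
  moreover have "\<Gamma> \<inter> L = cyl [x] [x]"
  proof (intro equalityI subsetI)
    fix \<gamma> assume "\<gamma> \<in> cyl [x] [x]"
    hence \<gamma>: "\<gamma> \<in> \<Gamma>" "\<gamma> x = x" by (auto simp: cyl_def)
    have "\<gamma> ` sphere x n \<subseteq> sphere x n" for n
      using act_edge[OF \<gamma>(1)] edge_in_V by (intro sphere_invariant \<gamma>) blast
    hence "\<gamma> \<in> K" using r act_ext[OF \<gamma>(1)] by (auto simp: K_def PiE_iff)
    moreover have "\<gamma> \<in> C y z" if "y \<in> V" "z \<in> V" for y z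
      using that \<gamma> act_inj act_edge Gamma_PiE by (auto simp: C_def)
    ultimately show "\<gamma> \<in> \<Gamma> \<inter> L" using \<gamma> by (auto simp: L_def)
  qed (use x in \<open>auto simp: cyl_def L_def C_def\<close>)
  ultimately show ?thesis by simp
qed

end

section \<open>Haar measure of stabilisers\<close>

text \<open>One left Haar measure is fixed, the candidate for not being right invariant.\<close>

locale haar_action = transitive_action +
  fixes M :: "('a \<Rightarrow> 'a) measure"
  assumes closed: "closedin (aut_topology V E) \<Gamma>"
    and haar: "left_haar_measure G T M"
begin

lemma radon: "radon_measure T M" and left_invariant: "\<gamma> \<in> \<Gamma> \<Longrightarrow> A \<in> sets M \<Longrightarrow> emeasure M (\<gamma> <#\<^bsub>G\<^esub> A) = emeasure M A"
  using haar by (simp_all add: left_haar_measure_def)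

lemma space_M: "space M = \<Gamma>" and sets_M: "sets M = sigma_sets \<Gamma> cylinders"
  using radon by (simp_all add: radon_measure_def topspace_T sigma_sets_cylinders)

lemma cyl_sets [measurable]: "set xs \<subseteq> V \<Longrightarrow> cyl xs ys \<in> sets M"
  using radon by (auto simp: radon_measure_def openin_cyl)

lemma emeasure_cyl_left:
  assumes "\<gamma> \<in> \<Gamma>" "set xs \<subseteq> V" "set ys \<subseteq> V"
  shows "emeasure M (cyl xs (map \<gamma> ys)) = emeasure M (cyl xs ys)"
  using left_invariant[OF assms(1) cyl_sets[OF assms(2)], of ys] unfolding cyl_left[OF assms] .

lemma emeasure_cyl:
  assumes "set xs \<subseteq> V" "cyl xs ys \<noteq> {}"
  shows "emeasure M (cyl xs ys) = emeasure M (cyl xs xs)"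
proof -
  obtain \<gamma> where "\<gamma> \<in> \<Gamma>" "ys = map \<gamma> xs" using assms(2) by (auto simp: cyl_def)
  thus ?thesis using emeasure_cyl_left assms(1) by simp
qed

definition weight :: "'a \<Rightarrow> ennreal" where
  "weight x = emeasure M (cyl [x] [x])"

lemma emeasure_cyl_vertex: "x \<in> V \<Longrightarrow> y \<in> V \<Longrightarrow> emeasure M (cyl [x] [y]) = weight x"
  unfolding weight_def by (rule emeasure_cyl) (auto simp: cyl_def elim: transE)

lemma weight_finite: "x \<in> V \<Longrightarrow> weight x < \<infinity>"
  using radon compactin_vertex_stabiliser[OF closed] by (auto simp: radon_measure_def weight_def)

text \<open>The countably many translates of a vertex stabiliser cover the group, so they cannot be null.\<close>

lemma weight_pos:
  assumes x: "x \<in> V" shows "weight x > 0"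
proof (rule ccontr)
  assume "\<not> weight x > 0"
  hence "cyl [x] [y] \<in> null_sets M" if "y \<in> V" for y
    using emeasure_cyl_vertex[OF x that] x by (auto intro!: null_setsI cyl_sets)
  hence "(\<Union>y\<in>V. cyl [x] [y]) \<in> null_sets M"
    using countable_V by (intro null_sets_UN') auto
  moreover have "(\<Union>y\<in>V. cyl [x] [y]) = space M" using x act_in by (auto simp: cyl_def space_M)
  ultimately show False using haar by (simp add: left_haar_measure_def null_sets_def)
qed

definition orbit :: "'a list \<Rightarrow> 'a list \<Rightarrow> 'a list set" where
  "orbit xs ys = (\<lambda>\<gamma>. map \<gamma> ys) ` cyl xs xs"

definition index :: "'a list \<Rightarrow> 'a list \<Rightarrow> ennreal" where
  "index xs ys = emeasure (count_space UNIV) (orbit xs ys)"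

lemma orbit_subset:
  assumes "set ys \<subseteq> V" shows "orbit xs ys \<subseteq> lists V"
proof
  fix zs assume "zs \<in> orbit xs ys"
  then obtain \<gamma> where \<gamma>: "\<gamma> \<in> \<Gamma>" and [simp]: "zs = map \<gamma> ys" by (auto simp: orbit_def cyl_def)
  show "zs \<in> lists V" using assms act_in[OF \<gamma>] by (auto simp: subset_iff)
qed

text \<open>The stabiliser of \<open>xs\<close> splits into translates of the stabiliser of \<open>xs @ ys\<close>, one for each point of the
  orbit of \<open>ys\<close>. Thus \<open>index\<close> is the index of one stabiliser in the other, a quantity that, unlike the
  measure, is visibly invariant under the action.\<close>

lemma emeasure_stabiliser:
  assumes "set xs \<subseteq> V" "set ys \<subseteq> V"
  shows "emeasure M (cyl xs xs) = index xs ys * emeasure M (cyl (xs @ ys) (xs @ ys))"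
proof -
  have countable: "countable (orbit xs ys)"
    using countable_V by (intro countable_subset[OF orbit_subset[OF assms(2)]] countable_lists)
  have "cyl xs xs = (\<Union>zs\<in>orbit xs ys. cyl (xs @ ys) (xs @ zs))"
    by (auto simp: orbit_def cyl_def)
  hence "emeasure M (cyl xs xs) = emeasure M (\<Union>zs\<in>orbit xs ys. cyl (xs @ ys) (xs @ zs))" by simp
  also have "\<dots> = (\<integral>\<^sup>+zs. emeasure M (cyl (xs @ ys) (xs @ zs)) \<partial>count_space (orbit xs ys))"
    using countable assms by (intro emeasure_UN_countable cyl_sets) (auto simp: disjoint_family_on_def cyl_def)
  also have "\<dots> = (\<integral>\<^sup>+zs. emeasure M (cyl (xs @ ys) (xs @ ys)) \<partial>count_space (orbit xs ys))"
  proof (rule nn_integral_cong)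
    fix zs assume "zs \<in> space (count_space (orbit xs ys))"
    hence "cyl (xs @ ys) (xs @ zs) \<noteq> {}" by (auto simp: orbit_def cyl_def)
    thus "emeasure M (cyl (xs @ ys) (xs @ zs)) = emeasure M (cyl (xs @ ys) (xs @ ys))"
      using assms by (intro emeasure_cyl) auto
  qed
  also have "\<dots> = index xs ys * emeasure M (cyl (xs @ ys) (xs @ ys))"
    by (cases "finite (orbit xs ys)") (simp_all add: index_def mult.commute)
  finally show ?thesis .
qed

text \<open>Conjugation by \<open>\<gamma>\<close> carries one pair of stabilisers to the other.\<close>

lemma index_invariant:
  assumes \<gamma>: "\<gamma> \<in> \<Gamma>" and V: "set xs \<subseteq> V" "set ys \<subseteq> V"
  shows "index (map \<gamma> xs) (map \<gamma> ys) = index xs ys"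
proof (rule antisym)
  have le: "index xs ys \<le> index (map \<gamma> xs) (map \<gamma> ys)"
    if \<gamma>: "\<gamma> \<in> \<Gamma>" and V: "set xs \<subseteq> V" "set ys \<subseteq> V" for \<gamma> xs ys
  proof -
    define \<gamma>' where "\<gamma>' = inverse_act \<gamma>"
    note \<gamma>' = inverse_act[OF \<gamma>, folded \<gamma>'_def]
    have sub: "map \<gamma> ` orbit xs ys \<subseteq> orbit (map \<gamma> xs) (map \<gamma> ys)"
    proof
      fix zs assume "zs \<in> map \<gamma> ` orbit xs ys"
      then obtain \<delta> where \<delta>: "\<delta> \<in> \<Gamma>" "map \<delta> xs = xs" "zs = map \<gamma> (map \<delta> ys)"
        by (auto simp: orbit_def cyl_def)
      define \<epsilon> where "\<epsilon> = compose V \<gamma> (compose V \<delta> \<gamma>')"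
      have \<epsilon>: "\<epsilon> \<in> \<Gamma>" unfolding \<epsilon>_def by (intro compose_closed \<gamma> \<gamma>' \<delta>)
      have conj: "map \<epsilon> (map \<gamma> us) = map \<gamma> (map \<delta> us)" if "set us \<subseteq> V" for us
      proof -
        have "set (map \<gamma> us) \<subseteq> V" using that act_in[OF \<gamma>] by (auto simp: subset_iff)
        moreover have "map \<gamma>' (map \<gamma> us) = us"
          unfolding map_map using that \<gamma>' by (intro map_idI) auto
        ultimately show ?thesis by (simp add: \<epsilon>_def map_compose del: map_map)
      qed
      show "zs \<in> orbit (map \<gamma> xs) (map \<gamma> ys)"
        using conj[OF V(1)] conj[OF V(2)] \<epsilon> \<delta>
        by (auto simp: orbit_def cyl_def simp del: map_map intro!: image_eqI[of _ _ \<epsilon>])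
    qed
    have "\<Union> (set ` orbit xs ys) \<subseteq> V"
      using orbit_subset[OF V(2), of xs] unfolding lists_eq_set by blast
    hence "inj_on \<gamma> (\<Union> (set ` orbit xs ys))"
      using bij_betw_imp_inj_on[OF act_bij[OF \<gamma>]] inj_on_subset by blast
    hence "inj_on (map \<gamma>) (orbit xs ys)" by (rule inj_on_mapI)
    hence "index xs ys = emeasure (count_space UNIV) (map \<gamma> ` orbit xs ys)"
      by (simp add: index_def emeasure_count_space finite_image_iff card_image)
    also have "\<dots> \<le> index (map \<gamma> xs) (map \<gamma> ys)"
      unfolding index_def by (intro emeasure_mono sub) auto
    finally show ?thesis .
  qed
  show "index xs ys \<le> index (map \<gamma> xs) (map \<gamma> ys)" by (rule le[OF \<gamma> V])
  define \<gamma>' where "\<gamma>' = inverse_act \<gamma>"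
  note \<gamma>' = inverse_act[OF \<gamma>, folded \<gamma>'_def]
  have "map \<gamma>' (map \<gamma> us) = us" if "set us \<subseteq> V" for us
    unfolding map_map using that \<gamma>' by (intro map_idI) auto
  moreover have "set (map \<gamma> us) \<subseteq> V" if "set us \<subseteq> V" for us
    using that act_in[OF \<gamma>] by (auto simp: subset_iff)
  ultimately show "index (map \<gamma> xs) (map \<gamma> ys) \<le> index xs ys"
    using le[OF \<gamma>'(1), of "map \<gamma> xs" "map \<gamma> ys"] V by (simp del: map_map set_map)
qed

text \<open>Both stabilisers contain the stabiliser of the pair, so their measures are in the ratio of the two
  indices.\<close>

lemma weight_less_iff:
  assumes "x \<in> V" "y \<in> V"
  shows "weight x < weight y \<longleftrightarrow> index [x] [y] < index [y] [x]"
proof -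
  let ?m = "emeasure M (cyl [x, y] [x, y])"
  have x: "weight x = index [x] [y] * ?m"
    using emeasure_stabiliser[of "[x]" "[y]"] assms by (simp add: weight_def)
  have y: "weight y = index [y] [x] * ?m"
    using emeasure_stabiliser[of "[y]" "[x]"] cyl_stabiliser_swap[of "[x]" "[y]"] assms
    by (simp add: weight_def)
  have "cyl [x, y] [x, y] \<subseteq> cyl [x] [x]" by (auto simp: cyl_def)
  hence "?m \<le> weight x" unfolding weight_def
    using assms by (intro emeasure_mono cyl_sets) auto
  hence "?m < \<infinity>" using weight_finite[OF assms(1)] by (simp add: order_le_less_trans)
  moreover have "?m > 0" using x weight_pos[OF assms(1)] by (auto simp: zero_less_iff_neq_zero)
  ultimately have "a < b \<Longrightarrow> a * ?m < b * ?m" for a b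
    by (intro ennreal_mult_strict_right_mono) auto
  moreover have "b \<le> a \<Longrightarrow> b * ?m \<le> a * ?m" for a b by (rule mult_right_mono) auto
  ultimately show ?thesis unfolding x y by (metis not_less)
qed

lemma weight_less_invariant:
  assumes "\<gamma> \<in> \<Gamma>" "x \<in> V" "y \<in> V"
  shows "weight (\<gamma> x) < weight (\<gamma> y) \<longleftrightarrow> weight x < weight y"
  using index_invariant[OF assms(1), of "[x]" "[y]"] index_invariant[OF assms(1), of "[y]" "[x]"] assms
  by (simp add: weight_less_iff act_in)

text \<open>Integrate \<open>f(v, \<gamma> v) = f(\<gamma>\<inverse> v, v)\<close> over \<open>\<gamma>\<close>. The set where \<open>\<gamma> v = y\<close> is a left translate of the
  stabiliser of \<open>v\<close>, and the set where \<open>\<gamma> y = v\<close> is a left translate of the stabiliser of \<open>y\<close>. The set \<open>S\<close>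
  bounds the range of the transport, so that both sums are finite.\<close>

lemma mass_transport:
  fixes f :: "'a \<Rightarrow> 'a \<Rightarrow> nat"
  assumes inv: "\<And>\<gamma> x y. \<gamma> \<in> \<Gamma> \<Longrightarrow> x \<in> V \<Longrightarrow> y \<in> V \<Longrightarrow> f (\<gamma> x) (\<gamma> y) = f x y"
    and v: "v \<in> V" and S: "finite S" "S \<subseteq> V"
    and supp: "\<And>y. y \<in> V \<Longrightarrow> f v y \<noteq> 0 \<Longrightarrow> y \<in> S" "\<And>y. y \<in> V \<Longrightarrow> f y v \<noteq> 0 \<Longrightarrow> y \<in> S"
  shows "(\<Sum>y\<in>S. of_nat (f v y) * weight v) = (\<Sum>y\<in>S. of_nat (f y v) * weight y)"
proof -
  have "(\<Sum>y\<in>S. of_nat (f v y) * weight v) =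
      (\<Sum>y\<in>S. \<integral>\<^sup>+\<gamma>. of_nat (f v y) * indicator (cyl [v] [y]) \<gamma> \<partial>M)"
    using v S by (intro sum.cong refl) (subst nn_integral_cmult_indicator, auto simp: emeasure_cyl_vertex)
  also have "\<dots> = (\<integral>\<^sup>+\<gamma>. (\<Sum>y\<in>S. of_nat (f v y) * indicator (cyl [v] [y]) \<gamma>) \<partial>M)"
    using v S by (intro nn_integral_sum[symmetric]) auto
  also have "\<dots> = (\<integral>\<^sup>+\<gamma>. (\<Sum>y\<in>S. of_nat (f y v) * indicator (cyl [y] [v]) \<gamma>) \<partial>M)"
  proof (rule nn_integral_cong)
    fix \<gamma> assume "\<gamma> \<in> space M"
    hence \<gamma>: "\<gamma> \<in> \<Gamma>" by (simp add: space_M)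
    define \<gamma>' where "\<gamma>' = inverse_act \<gamma>"
    note \<gamma>' = inverse_act[OF \<gamma>, folded \<gamma>'_def]
    have "(\<Sum>y\<in>S. of_nat (f v y) * indicator (cyl [v] [y]) \<gamma>) =
        (\<Sum>y\<in>S. if y = \<gamma> v then of_nat (f v y) else (0::ennreal))"
      using \<gamma> by (intro sum.cong) (auto simp: cyl_def indicator_def)
    also have "\<dots> = of_nat (f v (\<gamma> v))"
      using S supp(1)[of "\<gamma> v"] act_in[OF \<gamma> v] by (auto simp: sum.delta')
    also have "f v (\<gamma> v) = f (\<gamma>' v) v"
      using inv[OF \<gamma>'(1) v act_in[OF \<gamma> v]] \<gamma>'(2)[OF v] by simp
    also have "of_nat (f (\<gamma>' v) v) = (\<Sum>y\<in>S. if y = \<gamma>' v then of_nat (f y v) else (0::ennreal))"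
      using S supp(2)[of "\<gamma>' v"] act_in[OF \<gamma>'(1) v] by (auto simp: sum.delta')
    also have "\<dots> = (\<Sum>y\<in>S. of_nat (f y v) * indicator (cyl [y] [v]) \<gamma>)"
    proof (intro sum.cong refl)
      fix y assume "y \<in> S"
      hence "y \<in> V" using S by blast
      hence "y = \<gamma>' v \<longleftrightarrow> \<gamma> y = v" using \<gamma>'(2)[of y] \<gamma>'(3)[OF v] by metis
      thus "(if y = \<gamma>' v then of_nat (f y v) else (0::ennreal)) = of_nat (f y v) * indicator (cyl [y] [v]) \<gamma>"
        using \<gamma> by (auto simp: cyl_def indicator_def)
    qed
    finally show "(\<Sum>y\<in>S. of_nat (f v y) * indicator (cyl [v] [y]) \<gamma>) =
        (\<Sum>y\<in>S. of_nat (f y v) * indicator (cyl [y] [v]) \<gamma> :: ennreal)" .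
  qed
  also have "\<dots> = (\<Sum>y\<in>S. \<integral>\<^sup>+\<gamma>. of_nat (f y v) * indicator (cyl [y] [v]) \<gamma> \<partial>M)"
    using S by (intro nn_integral_sum) auto
  also have "\<dots> = (\<Sum>y\<in>S. of_nat (f y v) * weight y)"
    using v S by (intro sum.cong refl) (subst nn_integral_cmult_indicator, auto simp: emeasure_cyl_vertex subset_iff)
  finally show ?thesis .
qed

text \<open>Right translation by \<open>\<gamma>\<close> takes a left translate of the stabiliser of \<open>xs\<close> to a left translate of
  the stabiliser of another tuple in the same orbit. By the index formula the two
  stabilisers have equal measure as soon as all vertex stabilisers do. So right translation
  preserves the measure of cylinders, and these determine the measure.\<close>

lemma right_haar_if_weight_constant:
  assumes const: "\<And>x y. x \<in> V \<Longrightarrow> y \<in> V \<Longrightarrow> weight x = weight y"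
  shows "right_haar_measure G T M"
proof -
  \<comment> \<open>Both stabilisers have the same finite index in stabilisers of vertices, which have equal measure.\<close>
  have stab: "emeasure M (cyl (map \<gamma> xs) (map \<gamma> xs)) = emeasure M (cyl xs xs)"
    if \<gamma>: "\<gamma> \<in> \<Gamma>" and xs: "set xs \<subseteq> V" for \<gamma> xs
  proof (cases xs)
    case (Cons x xs')
    have x: "x \<in> V" "\<gamma> x \<in> V" using xs Cons act_in[OF \<gamma>] by auto
    have 1: "weight x = index [x] xs' * emeasure M (cyl xs xs)"
      using emeasure_stabiliser[of "[x]" xs'] xs by (simp add: weight_def Cons)
    have "weight (\<gamma> x) = index (map \<gamma> [x]) (map \<gamma> xs') * emeasure M (cyl (map \<gamma> xs) (map \<gamma> xs))"
      using emeasure_stabiliser[of "[\<gamma> x]" "map \<gamma> xs'"] xs act_in[OF \<gamma>] by (auto simp: weight_def Cons)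
    also have "index (map \<gamma> [x]) (map \<gamma> xs') = index [x] xs'"
      using xs Cons by (intro index_invariant \<gamma>) auto
    finally have 2: "weight x = index [x] xs' * emeasure M (cyl (map \<gamma> xs) (map \<gamma> xs))"
      using const[OF x] by simp
    have "index [x] xs' \<noteq> 0" using 1 weight_pos[OF x(1)] by auto
    moreover have "index [x] xs' \<noteq> \<infinity>"
      using 1 weight_pos[OF x(1)] weight_finite[OF x(1)] by (auto simp: ennreal_top_mult split: if_splits)
    moreover note trans[OF 2[symmetric] 1]
    ultimately show ?thesis by (simp add: ennreal_mult_cancel_left)
  qed simp
  have cyl_inv: "emeasure M (cyl (map \<gamma> xs) ys) = emeasure M (cyl xs ys)"
    if \<gamma>: "\<gamma> \<in> \<Gamma>" and xs: "set xs \<subseteq> V" for \<gamma> xs ys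
  proof -
    define \<gamma>' where "\<gamma>' = inverse_act \<gamma>"
    note \<gamma>' = inverse_act[OF \<gamma>, folded \<gamma>'_def]
    have sub: "set (map \<gamma> xs) \<subseteq> V" using xs act_in[OF \<gamma>] by (auto simp: subset_iff)
    have restore: "map \<gamma>' (map \<gamma> xs) = xs" unfolding map_map using xs \<gamma>' by (intro map_idI) auto
    have "cyl (map \<gamma> xs) ys = {}" if "cyl xs ys = {}"
      using cyl_right[OF \<gamma> xs, of ys] that by simp
    moreover have "cyl xs ys = {}" if "cyl (map \<gamma> xs) ys = {}"
      using cyl_right[OF \<gamma>'(1) sub, of ys] that unfolding restore by simp
    ultimately have "cyl (map \<gamma> xs) ys = {} \<longleftrightarrow> cyl xs ys = {}" by blast
    thus ?thesis
      using emeasure_cyl[OF sub] emeasure_cyl[OF xs] stab[OF \<gamma> xs] by (cases "cyl xs ys = {}") simp_all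
  qed
  have "emeasure M (A #>\<^bsub>G\<^esub> \<gamma>) = emeasure M A" if \<gamma>: "\<gamma> \<in> \<Gamma>" and A: "A \<in> sets M" for \<gamma> A
  proof -
    define \<gamma>' where "\<gamma>' = inverse_act \<gamma>"
    note \<gamma>' = inverse_act[OF \<gamma>, folded \<gamma>'_def]
    define \<phi> where "\<phi> \<delta> = compose V \<delta> \<gamma>'" for \<delta> :: "'a \<Rightarrow> 'a"
    have pre: "\<phi> -` cyl xs ys \<inter> space M = cyl (map \<gamma>' xs) ys" if "set xs \<subseteq> V" for xs ys
      unfolding cyl_right[OF \<gamma>'(1) that, symmetric] by (auto simp: \<phi>_def space_M)
    have [measurable]: "\<phi> \<in> measurable M M"
    proof (rule measurable_sigma_sets[OF sets_M])
      show "cylinders \<subseteq> Pow \<Gamma>" by (auto simp: cylinders_def cyl_def)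
      show "\<phi> \<in> space M \<rightarrow> \<Gamma>" by (simp add: \<phi>_def space_M compose_closed \<gamma>'(1))
      fix A assume "A \<in> cylinders"
      then obtain xs ys where "A = cyl xs ys" "set xs \<subseteq> V" by (auto simp: cylinders_def)
      thus "\<phi> -` A \<inter> space M \<in> sets M"
        using act_in[OF \<gamma>'(1)] by (auto simp: pre subset_iff intro!: cyl_sets)
    qed
    obtain v where v: "v \<in> V" using connected by (auto simp: connected_graph_def)
    \<comment> \<open>\<open>distr M M \<phi>\<close> is the measure \<open>A \<mapsto> M (A \<gamma>)\<close>; the two measures agree on cylinders.\<close>
    have "M = distr M M \<phi>"
    proof (rule measure_eqI_generator_eq_countable[OF Int_stable_cylinders])
      show "cylinders \<subseteq> Pow \<Gamma>" by (auto simp: cylinders_def cyl_def)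
      show "emeasure M X = emeasure (distr M M \<phi>) X" if "X \<in> cylinders" for X
      proof -
        obtain xs ys where "X = cyl xs ys" "set xs \<subseteq> V" using \<open>X \<in> cylinders\<close> by (auto simp: cylinders_def)
        thus ?thesis using \<gamma>' by (simp add: emeasure_distr pre cyl_inv)
      qed
      let ?A = "(\<lambda>y. cyl [v] [y]) ` V"
      show "?A \<subseteq> cylinders" using v by (fastforce simp: cylinders_def)
      show "\<Union>?A = \<Gamma>" using v act_in by (auto simp: cyl_def)
      show "countable ?A" using countable_V by simp
      show "emeasure M a \<noteq> \<infinity>" if "a \<in> ?A" for a
        using that v weight_finite by (auto simp: emeasure_cyl_vertex less_top)
    qed (simp_all add: sets_M)
    hence "emeasure M A = emeasure (distr M M \<phi>) A" by simp
    also have "\<dots> = emeasure M (\<phi> -` A \<inter> space M)" using A by (simp add: emeasure_distr)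
    also have "\<phi> -` A \<inter> space M = A #>\<^bsub>G\<^esub> \<gamma>"
    proof -
      have sub: "A \<subseteq> \<Gamma>" using sets.sets_into_space[OF A] by (simp add: space_M)
      have 1: "\<phi> (compose V \<delta> \<gamma>) = \<delta>" if "\<delta> \<in> \<Gamma>" for \<delta>
        using that \<gamma> \<gamma>'
        by (intro act_ext_eq) (auto simp: \<phi>_def compose_closed compose_eq act_in)
      have 2: "compose V (\<phi> \<delta>) \<gamma> = \<delta>" if "\<delta> \<in> \<Gamma>" for \<delta>
        using that \<gamma> \<gamma>'
        by (intro act_ext_eq) (auto simp: \<phi>_def compose_closed compose_eq act_in)
      show ?thesis unfolding r_coset_eq[OF \<gamma> sub] space_M
      proof (intro equalityI subsetI)
        fix \<delta> assume "\<delta> \<in> \<phi> -` A \<inter> \<Gamma>"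
        thus "\<delta> \<in> (\<lambda>\<delta>. compose V \<delta> \<gamma>) ` A" using 2[of \<delta>] by (metis IntE image_eqI vimageE)
      qed (use sub 1 compose_closed \<gamma> in auto)
    qed
    finally show ?thesis by simp
  qed
  thus ?thesis using haar by (simp add: right_haar_measure_def left_haar_measure_def)
qed

text \<open>Along a path between two vertices of different weight some edge changes the weight. Oriented from
  its lighter end, this edge can be moved to any vertex \<open>v\<close>.\<close>

lemma heavier_neighbour:
  assumes "\<not> right_haar_measure G T M" and "v \<in> V"
  obtains w where "{v, w} \<in> E" "weight v < weight w"
proof -
  obtain x y where xy: "x \<in> V" "y \<in> V" "weight x \<noteq> weight y"
    using assms right_haar_if_weight_constant by blast
  have "(x, y) \<in> {(a, b). {a, b} \<in> E}\<^sup>*" using connected xy by (auto simp: connected_graph_def)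
  hence "\<exists>a b. {a, b} \<in> E \<and> weight a \<noteq> weight b"
    using xy(3)
  proof (induction rule: rtrancl_induct)
    case (step y z)
    thus ?case by (cases "weight x = weight y") auto
  qed simp
  then obtain a b where "{a, b} \<in> E" "weight a < weight b"
    by (metis insert_commute linorder_neq_iff)
  moreover have "a \<in> V" "b \<in> V" using \<open>{a, b} \<in> E\<close> edge_in_V by auto
  moreover obtain \<gamma> where "\<gamma> \<in> \<Gamma>" "\<gamma> a = v" using transE[OF \<open>a \<in> V\<close> assms(2)] .
  ultimately show ?thesis
    using that[of "\<gamma> b"] act_edge[of \<gamma> a b] weight_less_invariant[of \<gamma> a b] by auto
qed

end

section \<open>First returns through heavy vertices\<close>

locale nonunimodular_action = haar_action +
  assumes not_right_haar: "\<not> right_haar_measure G T M"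
begin

lemma neighbours_image:
  assumes "\<gamma> \<in> \<Gamma>" "x \<in> V" shows "neighbours E (\<gamma> x) = \<gamma> ` neighbours E x"
proof (intro equalityI subsetI)
  fix y assume "y \<in> neighbours E (\<gamma> x)"
  hence e: "{\<gamma> x, y} \<in> E" by (simp add: neighbours_def)
  hence "y \<in> \<gamma> ` V" using edge_in_V act_bij[OF assms(1)] by (auto simp: bij_betw_def)
  then obtain z where "z \<in> V" "y = \<gamma> z" by blast
  thus "y \<in> \<gamma> ` neighbours E x" using e act_edge[OF assms] by (auto simp: neighbours_def)
next
  fix y assume "y \<in> \<gamma> ` neighbours E x"
  then obtain z where "{x, z} \<in> E" "y = \<gamma> z" by (auto simp: neighbours_def)
  thus "y \<in> neighbours E (\<gamma> x)" using edge_in_V[of x z] act_edge[OF assms, of z] by (simp add: neighbours_def)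
qed

text \<open>All vertices have the same degree by transitivity; the choice of \<open>v\<close> is immaterial.\<close>

definition degree :: nat where "degree = card (neighbours E (SOME v. v \<in> V))"

sublocale regular_graph V E degree
proof
  obtain v0 where "v0 \<in> V" using connected by (auto simp: connected_graph_def)
  hence v: "(SOME v. v \<in> V) \<in> V" by (rule someI)
  fix x assume x: "x \<in> V"
  show "neighbours E x \<subseteq> V" using edge_in_V by (auto simp: neighbours_def)
  show "finite (neighbours E x)" using locally_finite x by (simp add: locally_finite_graph_def)
  obtain \<gamma> where \<gamma>: "\<gamma> \<in> \<Gamma>" "\<gamma> (SOME v. v \<in> V) = x" using transE[OF v x] .
  have "inj_on \<gamma> (neighbours E (SOME v. v \<in> V))"
    using edge_in_V bij_betw_imp_inj_on[OF act_bij[OF \<gamma>(1)]]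
    by (elim inj_on_subset) (auto simp: neighbours_def)
  thus "card (neighbours E x) = degree"
    using neighbours_image[OF \<gamma>(1) v] by (simp add: degree_def \<gamma>(2) card_image)
next
  obtain v0 where "v0 \<in> V" using connected by (auto simp: connected_graph_def)
  hence v: "(SOME v. v \<in> V) \<in> V" by (rule someI)
  obtain w where "{SOME v. v \<in> V, w} \<in> E" using heavier_neighbour[OF not_right_haar v] .
  hence "neighbours E (SOME v. v \<in> V) \<noteq> {}" by (auto simp: neighbours_def)
  thus "degree > 0"
    using locally_finite v by (simp add: degree_def card_gt_0_iff locally_finite_graph_def)
qed

lemma successively_act:
  assumes "\<gamma> \<in> \<Gamma>" "set xs \<subseteq> V"
  shows "successively (\<lambda>a b. {a, b} \<in> E) (map \<gamma> xs) \<longleftrightarrow> successively (\<lambda>a b. {a, b} \<in> E) xs"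
  unfolding successively_map using assms by (intro successively_cong) (auto simp: act_edge subset_iff)

lemma inj_on_map_act:
  assumes "\<gamma> \<in> \<Gamma>" shows "inj_on (map \<gamma>) (lists V)"
proof (rule inj_on_mapI, rule inj_on_subset)
  show "inj_on \<gamma> V" by (rule bij_betw_imp_inj_on[OF act_bij[OF assms]])
  show "\<Union> (set ` lists V) \<subseteq> V" unfolding lists_eq_set by blast
qed

lemma card_closed_walks_act:
  assumes "x \<in> V" "y \<in> V"
  shows "card (walks_between E x x n) = card (walks_between E y y n)"
proof -
  have le: "card (walks_between E x x n) \<le> card (walks_between E y y n)" if xy: "x \<in> V" "y \<in> V" for x y
  proof -
    obtain \<gamma> where \<gamma>: "\<gamma> \<in> \<Gamma>" "\<gamma> x = y" using transE[OF xy] .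
    have sub: "set xs \<subseteq> V" if "xs \<in> walks_between E x x n" for xs
      using that walks_from_subset[OF xy(1), of xs n] by (simp add: walks_between_def)
    have "map \<gamma> ` walks_between E x x n \<subseteq> walks_between E y y n"
    proof (intro subsetI, elim imageE)
      fix zs xs assume "zs = map \<gamma> xs" "xs \<in> walks_between E x x n"
      moreover from this have "xs \<noteq> []" by (auto simp: walks_between_def walks_from_def)
      ultimately show "zs \<in> walks_between E y y n"
        using successively_act[OF \<gamma>(1), of xs] sub \<gamma>(2)
        by (simp add: walks_between_def walks_from_def hd_map last_map)
    qed
    moreover have "inj_on (map \<gamma>) (walks_between E x x n)"
      by (rule inj_on_subset[OF inj_on_map_act[OF \<gamma>(1)]]) (use sub in \<open>auto simp: lists_eq_set\<close>)
    ultimately show ?thesis using finite_walks_between[OF xy(2)] by (metis card_image card_mono)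
  qed
  show ?thesis using le assms by (meson antisym)
qed

text \<open>The closed walks \<open>[v] @ p @ [y] @ q @ [v]\<close> which visit the heavier vertex \<open>y\<close> exactly once, after
  \<open>i + 1\<close> steps, encoded by their two halves: exchanging \<open>p\<close> and \<open>q\<close> moves the starting point to \<open>y\<close>.\<close>

definition marked_walks :: "'a \<Rightarrow> nat \<Rightarrow> nat \<Rightarrow> 'a \<Rightarrow> ('a list \<times> 'a list) set" where
  "marked_walks v i j y = {(p, q). length p = i \<and> length q = j \<and>
     successively (\<lambda>a b. {a, b} \<in> E) ([v] @ p @ [y] @ q @ [v]) \<and>
     y \<notin> set p \<and> y \<notin> set q \<and> weight v < weight y}"

lemma marked_walk:
  assumes "(p, q) \<in> marked_walks v i j y"
  shows "[v] @ p @ [y] @ q @ [v] \<in> walks_between E v v (i + j + 2)"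
  using assms by (auto simp: marked_walks_def walks_between_def walks_from_def)

lemma marked_walk_rotate:
  assumes "(p, q) \<in> marked_walks y i j v"
  shows "[v] @ q @ [y] @ p @ [v] \<in> first_return_walks E v (i + j + 2)"
proof -
  have pq: "length p = i" "length q = j" "v \<notin> set (q @ [y] @ p)"
    and succ: "successively (\<lambda>a b. {a, b} \<in> E) ([y] @ p @ [v] @ q @ [y])"
    using assms by (auto simp: marked_walks_def)
  have "successively (\<lambda>a b. {a, b} \<in> E) ([v] @ q @ [y] @ p @ [v])"
    using succ by (cases "p = []"; cases "q = []") (auto simp: successively_append_iff successively_Cons)
  hence "[v] @ q @ [y] @ p @ [v] \<in> walks_between E v v (i + j + 2)"
    using pq by (auto simp: walks_between_def walks_from_def)
  moreover have "([v] @ q @ [y] @ p @ [v]) ! k \<noteq> v" if "k \<in> {1..<i + j + 2}" for k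
  proof -
    have "([v] @ q @ [y] @ p @ [v]) ! k = (q @ [y] @ p) ! (k - 1)"
      using that pq by (auto simp: nth_append nth_Cons')
    also have "\<dots> \<in> set (q @ [y] @ p)"
      using that pq by (intro nth_mem) auto
    finally show ?thesis using pq(3) by metis
  qed
  ultimately show ?thesis by (simp add: first_return_walks_def)
qed

lemma finite_marked_walks: "v \<in> V \<Longrightarrow> finite (marked_walks v i j y)"
proof -
  assume v: "v \<in> V"
  have "inj_on (\<lambda>(p, q). [v] @ p @ [y] @ q @ [v]) (marked_walks v i j y)"
    by (auto simp: inj_on_def marked_walks_def)
  moreover have "finite ((\<lambda>(p, q). [v] @ p @ [y] @ q @ [v]) ` marked_walks v i j y)"
    by (rule finite_subset[OF _ finite_walks_between[OF v]]) (use marked_walk in auto)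
  ultimately show ?thesis by (rule finite_imageD[rotated])
qed

lemma marked_walks_subset:
  assumes "v \<in> V" "(p, q) \<in> marked_walks v i j y"
  shows "set p \<subseteq> V" "set q \<subseteq> V" "y \<in> V"
proof -
  have "set ([v] @ p @ [y] @ q @ [v]) \<subseteq> V"
    using marked_walk[OF assms(2)] by (intro walks_from_subset[OF assms(1)]) (auto simp: walks_between_def)
  thus "set p \<subseteq> V" "set q \<subseteq> V" "y \<in> V" by auto
qed

lemma card_marked_walks_act:
  assumes \<gamma>: "\<gamma> \<in> \<Gamma>" and "v \<in> V" "y \<in> V"
  shows "card (marked_walks (\<gamma> v) i j (\<gamma> y)) = card (marked_walks v i j y)"
proof (rule antisym)
  have le: "card (marked_walks v i j y) \<le> card (marked_walks (\<gamma> v) i j (\<gamma> y))"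
    if \<gamma>: "\<gamma> \<in> \<Gamma>" and V: "v \<in> V" "y \<in> V" for \<gamma> v y
  proof -
    let ?h = "map_prod (map \<gamma>) (map \<gamma>)"
    have "?h ` marked_walks v i j y \<subseteq> marked_walks (\<gamma> v) i j (\<gamma> y)"
    proof (intro subsetI, elim imageE)
      fix z pq assume z: "z = ?h pq" "pq \<in> marked_walks v i j y"
      obtain p q where [simp]: "pq = (p, q)" by (cases pq)
      have sub: "set p \<subseteq> V" "set q \<subseteq> V" using z(2) marked_walks_subset[OF V(1), of p q i j y] by auto
      have "successively (\<lambda>a b. {a, b} \<in> E) (map \<gamma> ([v] @ p @ [y] @ q @ [v]))"
        using z(2) sub V by (subst successively_act[OF \<gamma>]) (auto simp: marked_walks_def)
      moreover have "\<gamma> y \<notin> \<gamma> ` set p" "\<gamma> y \<notin> \<gamma> ` set q"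
        using z(2) sub V by (auto simp: marked_walks_def act_inj[OF \<gamma>] subset_iff)
      ultimately show "z \<in> marked_walks (\<gamma> v) i j (\<gamma> y)"
        using z weight_less_invariant[OF \<gamma> V] by (auto simp: marked_walks_def)
    qed
    moreover have "inj_on ?h (marked_walks v i j y)"
    proof (rule inj_on_subset)
      show "inj_on ?h (lists V \<times> lists V)"
        by (intro map_prod_inj_on inj_on_map_act \<gamma>)
      show "marked_walks v i j y \<subseteq> lists V \<times> lists V"
      proof clarify
        fix p q assume pq: "(p, q) \<in> marked_walks v i j y"
        show "p \<in> lists V \<and> q \<in> lists V"
          using marked_walks_subset[OF V(1) pq] by (simp add: lists_eq_set)
      qed
    qed
    ultimately show ?thesis
      using finite_marked_walks[OF act_in[OF \<gamma> V(1)]] by (metis card_image card_mono)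
  qed
  show "card (marked_walks v i j y) \<le> card (marked_walks (\<gamma> v) i j (\<gamma> y))"
    by (rule le[OF assms])
  define \<gamma>' where "\<gamma>' = inverse_act \<gamma>"
  note \<gamma>' = inverse_act[OF \<gamma>, folded \<gamma>'_def]
  show "card (marked_walks (\<gamma> v) i j (\<gamma> y)) \<le> card (marked_walks v i j y)"
    using le[OF \<gamma>'(1) act_in[OF \<gamma>] act_in[OF \<gamma>], of v y] \<gamma>'(2)[of v] \<gamma>'(2)[of y] assms by simp
qed

text \<open>A finite set that contains every \<open>y\<close> for which there are marked walks between \<open>v\<close> and \<open>y\<close>, in either
  role; it serves as the support in the mass transport.\<close>

definition near :: "'a \<Rightarrow> nat \<Rightarrow> 'a set" where
  "near v n = \<Union> (set ` walks_between E v v n)"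

lemma finite_near: "v \<in> V \<Longrightarrow> finite (near v n)"
  using finite_walks_between by (auto simp: near_def)

lemma near_subset: "v \<in> V \<Longrightarrow> near v n \<subseteq> V"
  using walks_from_subset by (fastforce simp: near_def walks_between_def)

lemma marked_near:
  assumes "v \<in> V" "marked_walks v i j y \<noteq> {}" shows "y \<in> near v (i + j + 2)"
proof -
  obtain p q where "(p, q) \<in> marked_walks v i j y" using assms(2) by auto
  hence "[v] @ p @ [y] @ q @ [v] \<in> walks_between E v v (i + j + 2)" by (rule marked_walk)
  thus ?thesis unfolding near_def by (rule UN_I) simp
qed

lemma marked_near':
  assumes "marked_walks y i j v \<noteq> {}" shows "y \<in> near v (i + j + 2)"
proof -
  obtain p q where "(p, q) \<in> marked_walks y i j v" using assms by auto
  hence "[v] @ q @ [y] @ p @ [v] \<in> walks_between E v v (i + j + 2)"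
    using marked_walk_rotate by (auto simp: first_return_walks_def)
  thus ?thesis unfolding near_def by (rule UN_I) simp
qed

text \<open>Read from the marked vertex, a marked walk is a first return, and the positions \<open>i\<close> and \<open>j\<close> being
  fixed, the marked walk can be recovered from it.\<close>

lemma sum_card_marked_walks_to:
  assumes v: "v \<in> V"
  shows "(\<Sum>y\<in>near v (i + j + 2). card (marked_walks y i j v)) \<le> card (first_return_walks E v (i + j + 2))"
proof -
  let ?N = "near v (i + j + 2)"
  let ?h = "\<lambda>(y, p, q). [v] @ q @ [y] @ p @ [v]"
  let ?D = "SIGMA y:?N. marked_walks y i j v"
  have fin: "\<forall>y\<in>?N. finite (marked_walks y i j v)"
    using near_subset[OF v] finite_marked_walks by blast
  have "inj_on ?h ?D"
    by (rule inj_on_inverseI[where g = "\<lambda>xs. (xs ! Suc j, take i (drop (j + 2) xs), take j (tl xs))"])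
      (auto simp: marked_walks_def nth_append)
  hence inj: "card (?h ` ?D) = card ?D" by (rule card_image)
  have "(\<Sum>y\<in>?N. card (marked_walks y i j v)) = card (?h ` ?D)"
    unfolding inj using finite_near[OF v] fin by simp
  also have "\<dots> \<le> card (first_return_walks E v (i + j + 2))"
  proof (rule card_mono)
    show "finite (first_return_walks E v (i + j + 2))"
      using finite_walks_between[OF v] by (simp add: first_return_walks_def)
    show "?h ` ?D \<subseteq> first_return_walks E v (i + j + 2)" using marked_walk_rotate by auto
  qed
  finally show ?thesis .
qed

text \<open>Mass transport exchanges the marked vertex and the starting point at the cost of the factor
  \<open>weight y / weight v\<close>. After the exchange \<open>v\<close> is the marked vertex, hence the heavier one, and the
  factor is at most \<open>1\<close>.\<close>

lemma sum_card_marked_walks_from: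
  assumes v: "v \<in> V"
  shows "(\<Sum>y\<in>near v (i + j + 2). card (marked_walks v i j y)) \<le> card (first_return_walks E v (i + j + 2))"
proof -
  let ?N = "near v (i + j + 2)"
  let ?A = "\<Sum>y\<in>?N. card (marked_walks v i j y)" and ?B = "\<Sum>y\<in>?N. card (marked_walks y i j v)"
  have "of_nat ?A * weight v = (\<Sum>y\<in>?N. of_nat (card (marked_walks v i j y)) * weight v)"
    by (simp add: sum_distrib_right)
  also have "\<dots> = (\<Sum>y\<in>?N. of_nat (card (marked_walks y i j v)) * weight y)"
  proof (rule mass_transport)
    fix y
    show "y \<in> ?N" if "card (marked_walks v i j y) \<noteq> 0"
      using that by (intro marked_near v) auto
    show "y \<in> ?N" if "card (marked_walks y i j v) \<noteq> 0"
      using that by (intro marked_near') auto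
  qed (simp_all add: card_marked_walks_act finite_near near_subset v)
  also have "\<dots> \<le> (\<Sum>y\<in>?N. of_nat (card (marked_walks y i j v)) * weight v)"
  proof (rule sum_mono)
    fix y
    show "of_nat (card (marked_walks y i j v)) * weight y \<le> of_nat (card (marked_walks y i j v)) * weight v"
    proof (cases "marked_walks y i j v = {}")
      case False
      hence "weight y \<le> weight v" by (auto simp: marked_walks_def)
      thus ?thesis by (intro mult_left_mono) auto
    qed simp
  qed
  also have "\<dots> = of_nat ?B * weight v" by (simp add: sum_distrib_right)
  finally have *: "of_nat ?A * weight v \<le> of_nat ?B * weight v" .
  have "?A \<le> ?B"
  proof (rule ccontr)
    assume "\<not> ?A \<le> ?B"
    hence "(of_nat ?B :: ennreal) < of_nat ?A" by (simp only: of_nat_less_iff not_le)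
    hence "of_nat ?B * weight v < of_nat ?A * weight v"
      using weight_pos[OF v] weight_finite[OF v] by (intro ennreal_mult_strict_right_mono) auto
    thus False using * by simp
  qed
  thus ?thesis using sum_card_marked_walks_to[OF v] by (meson order_trans)
qed

text \<open>The detour leaves the walk at a vertex \<open>z\<close> of maximal weight, so the heavier neighbour \<open>y\<close> of \<open>z\<close> is
  visited only by the detour. The piece \<open>v # p\<close> ends at \<open>z\<close> and the piece \<open>q @ [v]\<close> starts there, so
  \<^const>\<open>tl\<close> drops the second copy of \<open>z\<close> when the walk is recovered.\<close>

lemma detour:
  assumes v: "v \<in> V" and xs: "xs \<in> walks_between E v v n"
  obtains k y p q where "k \<le> n" "(p, q) \<in> marked_walks v k (n - k) y" "xs = v # p @ tl (q @ [v])"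
proof -
  have len: "length xs = Suc n" and ne: "xs \<noteq> []" and hd: "hd xs = v" and last: "last xs = v"
    and succ: "successively (\<lambda>a b. {a, b} \<in> E) xs"
    using xs by (auto simp: walks_between_def walks_from_def)
  have "Max (weight ` set xs) \<in> weight ` set xs" using ne by (intro Max_in) auto
  then obtain z where z: "z \<in> set xs" "weight z = Max (weight ` set xs)" by force
  obtain k where k: "k \<le> n" "xs ! k = z" using z(1) len by (auto simp: in_set_conv_nth less_Suc_eq_le)
  have max: "weight x \<le> weight z" if "x \<in> set xs" for x using that z(2) by simp
  have "z \<in> V" using xs z(1) walks_from_subset[OF v] by (auto simp: walks_between_def)
  then obtain y where y: "{z, y} \<in> E" "weight z < weight y"
    using heavier_neighbour[OF not_right_haar] by blast
  have y_notin: "y \<notin> set xs" using max y(2) by (meson leD)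
  define p where "p = tl (take (Suc k) xs)"
  define q where "q = butlast (drop k xs)"
  have vp: "v # p = take (Suc k) xs" using ne hd by (cases xs) (auto simp: p_def)
  have qv: "q @ [v] = drop k xs"
    using k len last append_butlast_last_id[of "drop k xs"] by (simp add: q_def)
  have split: "xs = take (Suc k) xs @ drop (Suc k) xs" "xs = take k xs @ drop k xs" by simp_all
  have "last (take (Suc k) xs) = z" using k len by (simp add: take_Suc_conv_app_nth)
  moreover have "hd (drop k xs) = z" using k len by (simp add: hd_drop_conv_nth)
  moreover have "successively (\<lambda>a b. {a, b} \<in> E) (take (Suc k) xs)"
    using succ split(1) by (metis successively_append_iff)
  moreover have "successively (\<lambda>a b. {a, b} \<in> E) (drop k xs)"
    using succ split(2) by (metis successively_append_iff)
  ultimately have "successively (\<lambda>a b. {a, b} \<in> E) ((v # p) @ [y] @ (q @ [v]))"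
    unfolding vp qv using y(1) by (auto simp: successively_append_iff successively_Cons insert_commute)
  moreover have "set p \<subseteq> set xs" "set q \<subseteq> set xs"
    using vp qv by (metis set_subset_Cons set_take_subset order_trans, metis set_append Un_upper1 set_drop_subset order_trans)
  moreover have "weight v < weight y"
    using max[of v] y(2) hd ne by (metis hd_in_set order_le_less_trans)
  moreover have "length p = k" "length q = n - k" using k len by (auto simp: p_def q_def)
  ultimately have "(p, q) \<in> marked_walks v k (n - k) y"
    using y_notin by (auto simp: marked_walks_def)
  moreover have "xs = v # p @ tl (q @ [v])"
  proof -
    have "tl (drop k xs) = drop (Suc k) xs" by (simp add: drop_Suc drop_tl)
    hence "(v # p) @ tl (q @ [v]) = xs" unfolding vp qv by simp
    thus ?thesis by simp
  qed
  ultimately show ?thesis using that k(1) by blast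
qed

lemma card_closed_walks_le_first_return:
  assumes v: "v \<in> V"
  shows "card (walks_between E v v n) \<le> (n + 1) * card (first_return_walks E v (n + 2))"
proof -
  let ?D = "SIGMA k:{..n}. SIGMA y:near v (n + 2). marked_walks v k (n - k) y"
  let ?h = "\<lambda>(k :: nat, y :: 'a, p, q). v # p @ tl (q @ [v])"
  have fin: "finite ?D"
    using finite_near[OF v] finite_marked_walks[OF v] by auto
  have "walks_between E v v n \<subseteq> ?h ` ?D"
  proof
    fix xs assume "xs \<in> walks_between E v v n"
    from detour[OF v this] obtain k y p q where
      *: "k \<le> n" "(p, q) \<in> marked_walks v k (n - k) y" "xs = v # p @ tl (q @ [v])" .
    have "y \<in> near v (n + 2)" using marked_near[OF v, of k "n - k" y] * by auto
    thus "xs \<in> ?h ` ?D" using * by (intro image_eqI[of _ _ "(k, y, p, q)"]) auto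
  qed
  hence "card (walks_between E v v n) \<le> card ?D"
    using fin by (meson card_image_le card_mono finite_imageI order_trans)
  also have "\<dots> = (\<Sum>k\<le>n. \<Sum>y\<in>near v (n + 2). card (marked_walks v k (n - k) y))"
    using finite_near[OF v] finite_marked_walks[OF v] by simp
  also have "\<dots> \<le> (\<Sum>k\<le>n. card (first_return_walks E v (n + 2)))"
  proof (rule sum_mono)
    fix k assume "k \<in> {..n}"
    thus "(\<Sum>y\<in>near v (n + 2). card (marked_walks v k (n - k) y)) \<le> card (first_return_walks E v (n + 2))"
      using sum_card_marked_walks_from[OF v, of k "n - k"] by simp
  qed
  also have "\<dots> = (n + 1) * card (first_return_walks E v (n + 2))" by simp
  finally show ?thesis .
qed

section \<open>Comparison of return and first return probabilities\<close>

lemma return_prob_le_first_return_prob: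
  assumes "v \<in> V"
  shows "return_prob E v n \<le> (real n + 1) * (real degree)\<^sup>2 * first_return_prob E v (n + 2)"
proof -
  have "real (card (walks_between E v v n)) \<le> (real n + 1) * card (first_return_walks E v (n + 2))"
    using of_nat_mono[OF card_closed_walks_le_first_return[OF assms, of n], where 'a = real]
    by (simp add: algebra_simps)
  hence "real (card (walks_between E v v n)) / degree ^ n
      \<le> (real n + 1) * card (first_return_walks E v (n + 2)) / degree ^ n"
    by (rule divide_right_mono) simp
  also have "\<dots> = (real n + 1) * (real degree)\<^sup>2 * (card (first_return_walks E v (n + 2)) / degree ^ (n + 2))"
    using degree_pos by (simp add: power_add field_simps power2_eq_square)
  finally show ?thesis by (simp add: return_prob_eq first_return_prob_eq assms)
qed

text \<open>In particular \<open>k = 2\<close> gives monotonicity along even times, and odd \<open>k\<close> bounds the return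
  probabilities at odd times.\<close>

lemma return_prob_even:
  assumes "v \<in> V" shows "return_prob E v (2 * m + k) \<le> return_prob E v (2 * m)"
proof -
  have "real (card (walks_between E v v (2 * m + k))) \<le> real degree ^ k * card (walks_between E v v (2 * m))"
    using of_nat_mono[OF card_closed_walks_le[OF assms, of m k], where 'a = real] by simp
  thus ?thesis using degree_pos
    by (simp add: return_prob_eq assms power_add divide_simps mult_ac)
qed

lemma return_prob_supermultiplicative:
  assumes "v \<in> V" shows "return_prob E v m * return_prob E v n \<le> return_prob E v (m + n)"
proof -
  have "real (card (walks_between E v v m)) * card (walks_between E v v n) \<le> card (walks_between E v v (m + n))"
    using of_nat_mono[OF card_closed_walks_supermultiplicative[OF assms, of m n], where 'a = real] by simp
  thus ?thesis using degree_pos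
    by (simp add: return_prob_eq assms power_add divide_simps)
qed

lemma first_return_lower_bound:
  "\<exists>c'>0. \<forall>x\<in>V. \<forall>n\<ge>1. first_return_prob E x n \<ge> c' * (return_prob E x n / real n)"
proof -
  obtain v where v: "v \<in> V" using connected by (auto simp: connected_graph_def)
  have indep: "return_prob E x n = return_prob E v n" if "x \<in> V" for x n
    using card_closed_walks_act[OF that v] by (simp add: return_prob_eq that v)
  have range: "0 \<le> return_prob E x n" "return_prob E x n \<le> 1" "0 \<le> first_return_prob E x n" for x n
    by (simp_all add: return_prob_def first_return_prob_def)
  define u where "u = return_prob E v"
  define odd_return where "odd_return s \<longleftrightarrow> odd s \<and> u s > 0" for s
  define s where "s = (LEAST s. odd_return s)"
  have s: "odd_return s" "s \<le> n" if "odd_return n" for n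
    unfolding s_def using that by (rule LeastI, rule Least_le)
  \<comment> \<open>The loss when \<open>n\<close> is replaced by \<open>n - 2\<close>; there is none in a bipartite graph, where odd returns do not occur.\<close>
  define r where "r = (if \<exists>s. odd_return s then u s else 1)"
  have r: "0 < r" "r \<le> 1" using s range by (auto simp: r_def odd_return_def u_def)
  have d1: "0 < real degree" "1 \<le> (real degree)\<^sup>2" using degree_pos by simp_all
  define c' where "c' = r / (real degree)\<^sup>2"
  have "r \<le> (real degree)\<^sup>2" using r(2) d1(2) by (rule order_trans)
  hence c': "0 < c'" "c' \<le> 1" using r d1(1) by (simp_all add: c'_def divide_le_eq)
  have "first_return_prob E x n \<ge> c' * (u n / n)" if x: "x \<in> V" and n: "n \<ge> 1" for x n
  proof -
    \<comment> \<open>The detour inequality at time \<open>n - 2\<close>, where \<open>(n - 2) + 1 \<le> n\<close>.\<close>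
    have two_less: ?thesis if n2: "2 \<le> n" and le: "r * u n \<le> u (n - 2)"
    proof -
      have "n - 2 + 2 = n" using n2 by simp
      hence "u (n - 2) \<le> (real (n - 2) + 1) * (real degree)\<^sup>2 * first_return_prob E x n"
        using return_prob_le_first_return_prob[OF x, of "n - 2"] by (simp only: u_def indep[OF x])
      with le have "r * u n \<le> (real (n - 2) + 1) * (real degree)\<^sup>2 * first_return_prob E x n"
        by (rule order_trans)
      also have "\<dots> \<le> real n * (real degree)\<^sup>2 * first_return_prob E x n"
        using n2 range by (intro mult_right_mono) auto
      finally show ?thesis using n d1 by (simp add: c'_def divide_simps mult_ac)
    qed
    show ?thesis
    proof (cases "even n")
      case True
      then obtain m where m: "n = 2 * m" by auto
      hence "n = 2 * (m - 1) + 2" using n by auto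
      hence "u n \<le> u (n - 2)" using return_prob_even[OF v, of "m - 1" 2] by (simp add: u_def)
      moreover have "r * u n \<le> u n" using r range by (simp add: u_def mult_left_le_one_le)
      ultimately show ?thesis using two_less n True by (cases "n = 1") auto
    next
      case False
      show ?thesis
      proof (cases "u n > 0")
        case True
        hence odd: "odd_return n" using False by (simp add: odd_return_def)
        hence s_odd: "odd s" and us: "u s > 0" and "s \<le> n" using s by (auto simp: odd_return_def)
        have r_eq: "r = u s" using odd by (auto simp: r_def)
        show ?thesis
        proof (cases "n = s")
          case True
          \<comment> \<open>At the smallest odd return time every return is a first return.\<close>
          have "walks_between E x x k = {}" if "odd k" "k < n" for k
          proof (rule ccontr)
            assume "walks_between E x x k \<noteq> {}"
            hence "u k > 0" using indep[OF x, of k] finite_walks_between[OF x] degree_pos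
              by (simp add: u_def return_prob_eq[OF x] card_gt_0_iff flip: indep[OF x])
            thus False using s(2)[of k] that True by (auto simp: odd_return_def)
          qed
          hence "first_return_walks E x n = walks_between E x x n"
            using False by (intro first_return_walks_eq_walks_between)
          hence "first_return_prob E x n = u n"
            using indep[OF x, of n] by (simp add: u_def first_return_prob_eq[OF x] return_prob_eq[OF x])
          moreover have "c' * (u n / n) \<le> 1 * (u n / 1)"
            using c' n range by (intro mult_mono divide_left_mono) (auto simp: u_def)
          ultimately show ?thesis by simp
        next
          case False
          with \<open>s \<le> n\<close> have "s < n" by simp
          moreover have "even (n - s)" using s_odd \<open>odd_return n\<close> by (simp add: odd_return_def)
          ultimately obtain m where "n = 2 * m + s" "m > 0"
            by (metis dvd_def le_add_diff_inverse2 less_imp_le nat_0_less_mult_iff zero_less_diff)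
          then obtain m' where n_eq: "n = 2 * m' + (s + 2)" by (cases m) auto
          have "r * u n \<le> u s * u (2 * m')"
            using return_prob_even[OF v, of m' "s + 2"] us unfolding r_eq u_def n_eq
            by (intro mult_left_mono) auto
          \<comment> \<open>Prefixing a closed walk of length \<open>s\<close> repairs the parity.\<close>
          also have "\<dots> \<le> u (s + 2 * m')"
            using return_prob_supermultiplicative[OF v] by (simp add: u_def)
          also have "s + 2 * m' = n - 2" by (simp add: n_eq)
          finally show ?thesis using two_less n_eq by simp
        qed
      next
        case False
        hence "u n = 0" using range[of v n] by (simp add: u_def)
        thus ?thesis using range by simp
      qed
    qed
  qed
  thus ?thesis using c' indep by (intro exI[of _ c']) (auto simp: u_def)
qed

end

theorem theorem1p5:
  fixes V :: "'a set" and E :: "'a set set" and \<Gamma> :: "('a \<Rightarrow> 'a) set"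
  assumes "simple_graph V E" and "locally_finite_graph V E" and "connected_graph V E"
    and "subgroup \<Gamma> (aut_group V E)"
    and "closedin (aut_topology V E) \<Gamma>"
    and "transitive_on \<Gamma> V"
    and "\<not> unimodular ((aut_group V E)\<lparr>carrier := \<Gamma>\<rparr>) (subtopology (aut_topology V E) \<Gamma>)"
  shows "\<exists>c>0. \<exists>c'>0. \<forall>x\<in>V. \<forall>n\<ge>1.
    first_return_prob E x n \<ge> c' * (return_prob E x n / real n powr c)"
proof -
  interpret transitive_action V E \<Gamma> by (rule transitive_action.intro) (use assms in simp_all)
  obtain M where "left_haar_measure G T M" "\<not> right_haar_measure G T M"
    using assms(7) by (auto simp: unimodular_def T_def)
  then interpret nonunimodular_action V E \<Gamma> M using assms(5) by unfold_locales
  obtain c' where "c' > 0"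
    "\<And>x n. x \<in> V \<Longrightarrow> n \<ge> 1 \<Longrightarrow> first_return_prob E x n \<ge> c' * (return_prob E x n / real n)"
    using first_return_lower_bound by blast
  thus ?thesis by (intro exI[of _ 1] conjI exI[of _ c']) auto
qed

end
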